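(* Let $\sigma_1,\sigma_2:\mathbb R^d\to\mathfrak t^d\cong\mathbb R^d$ be linear bijections, viewed as elements of $\mathrm{GL}(d,\mathbb R)$. If they define distinct classes in the double quotient $$\mathrm{GL}(d,\mathbb Z)\backslash\mathrm{GL}(d,\mathbb R)/\mathrm O(d),$$ then the Taub-NUT deformations of order $d$ $g_{\mathrm{TN}_{\sigma_1}}$ and $g_{\mathrm{TN}_{\sigma_2}}$ of the Euclidean metric of $\mathbb H^d$ are not isometric.
   Context: Identify $\mathbb H^d=\mathbb C^d\times\mathbb C^d$ via $(z,w)\mapsto z+wj$, with Euclidean metric and complex structures given by left multiplication by $i,j,k$. The diagonal torus $T^d$ (Lie algebra $\mathfrak t^d\cong\mathbb R^d$ with $\exp(t_1,\dots,t_d)=\mathrm{diag}(e^{it_1},\dots,e^{it_d})$) acts by $z_k\mapsto e^{-it_k}z_k$, $w_k\mapsto e^{it_k}w_k$, with moment map $\mu:\mathbb H^d\to\mathbb R^3\otimes(\mathfrak t^d)^*$, $\mu_1=\frac12\sum_k(|w_k|^2-|z_k|^2)e_k^*$, $\mu_2+\sqrt{-1}\mu_3=\sqrt{-1}\sum_k z_kw_ke_k^*$. For a linear bijection $\sigma:\mathbb R^d\to\mathfrak t^d$, $\mathbb R^d$ acts on $\mathbb H^d$ via $\sigma$ with moment map $\mu_\sigma=(\mathrm{Id}\otimes\sigma^* )\circ\mu$, and on a second copy of $\mathbb H^d\cong(\mathbb R^d)^4$ by translation of the real part $q_0$, with moment map $\lambda(q_0,q_1,q_2,q_3)=-(q_1,q_2,q_3)$.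 The Taub-NUT deformation of order $d$ specified by $\sigma$ is the hyperkähler quotient $(\mu_\sigma+\lambda)^{-1}(0)/\mathbb R^d$ of $\mathbb H^d\times\mathbb H^d$ by $\mathbb R^d$, with metric $g_{\mathrm{TN}_\sigma}$; it is naturally diffeomorphic to $\mathbb H^d$. In the double quotient, $\mathrm{GL}(d,\mathbb Z)$ acts by multiplication on the left and $\mathrm O(d)$ on the right. *)

theory Defs
  imports "HOL-Analysis.Analysis"
begin

section \<open>Smooth maps and isometries of Riemannian metrics on a Euclidean space\<close>

primrec C_diff :: "nat \<Rightarrow> ('a::euclidean_space \<Rightarrow> 'b::euclidean_space) \<Rightarrow> bool" where
  "C_diff 0 f \<longleftrightarrow> continuous_on UNIV f"
| "C_diff (Suc n) f \<longleftrightarrow>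
     (\<forall>x. f differentiable (at x)) \<and> (\<forall>v. C_diff n (\<lambda>x. frechet_derivative f (at x) v))"

definition smooth_map :: "('a::euclidean_space \<Rightarrow> 'b::euclidean_space) \<Rightarrow> bool" where
  "smooth_map f \<longleftrightarrow> (\<forall>n. C_diff n f)"

definition diffeo :: "('a::euclidean_space \<Rightarrow> 'b::euclidean_space) \<Rightarrow> bool" where
  "diffeo f \<longleftrightarrow> bij f \<and> smooth_map f \<and> smooth_map (inv f)"

text \<open>A Riemannian metric on a Euclidean space, regarded as a manifold, is given by
  \<open>g x u v\<close> with \<open>x\<close> the base point and \<open>u, v\<close> tangent vectors.\<close>

type_synonym 'a metric_tensor = "'a \<Rightarrow> 'a \<Rightarrow> 'a \<Rightarrow> real"

definition isometric ::
  "'a::euclidean_space metric_tensor \<Rightarrow> 'b::euclidean_space metric_tensor \<Rightarrow> bool" where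
  "isometric g h \<longleftrightarrow> (\<exists>f. diffeo f \<and>
     (\<forall>x u v. h (f x) (frechet_derivative f (at x) u) (frechet_derivative f (at x) v) = g x u v))"


section \<open>Quaternionic space, the torus action and its moment map\<close>

text \<open>The pair \<open>(z, w)\<close> stands for \<open>z + w j\<close>.  The product inner product is the Euclidean one.\<close>

type_synonym 'd quat = "(complex ^ 'd) \<times> (complex ^ 'd)"

text \<open>The coordinates in \<open>z + w j = q0 + q1 i + q2 j + q3 k\<close>.\<close>

definition q0 :: "'d::finite quat \<Rightarrow> real ^ 'd" where "q0 x = (\<chi> k. Re (fst x $ k))"
definition q1 :: "'d::finite quat \<Rightarrow> real ^ 'd" where "q1 x = (\<chi> k. Im (fst x $ k))"
definition q2 :: "'d::finite quat \<Rightarrow> real ^ 'd" where "q2 x = (\<chi> k. Re (snd x $ k))"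
definition q3 :: "'d::finite quat \<Rightarrow> real ^ 'd" where "q3 x = (\<chi> k. Im (snd x $ k))"

definition of_coords :: "real ^ 'd \<Rightarrow> real ^ 'd \<Rightarrow> real ^ 'd \<Rightarrow> real ^ 'd \<Rightarrow> 'd::finite quat" where
  "of_coords a b c e = (\<chi> k. Complex (a $ k) (b $ k), \<chi> k. Complex (c $ k) (e $ k))"

text \<open>The action of \<open>exp t\<close>, where \<open>t\<close> is in the Lie algebra of the torus.\<close>

definition torus_act :: "real ^ 'd \<Rightarrow> 'd::finite quat \<Rightarrow> 'd quat" where
  "torus_act t x = (\<chi> k. cis (- (t $ k)) * fst x $ k, \<chi> k. cis (t $ k) * snd x $ k)"

text \<open>The dual basis identifies the duals of the Lie algebras with \<open>real ^ 'd\<close>; under these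
  identifications the transpose of a linear map is its \<^const>\<open>adjoint\<close>.  The three components of a
  hyperkaehler moment map form a triple.\<close>

type_synonym 'd mom = "(real ^ 'd) \<times> (real ^ 'd) \<times> (real ^ 'd)"

definition torus_moment :: "'d::finite quat \<Rightarrow> 'd mom" where
  "torus_moment x =
    (\<chi> k. ((cmod (snd x $ k))\<^sup>2 - (cmod (fst x $ k))\<^sup>2) / 2,
     \<chi> k. Re (\<i> * (fst x $ k * snd x $ k)),
     \<chi> k. Im (\<i> * (fst x $ k * snd x $ k)))"

definition mu_sigma :: "(real ^ 'd \<Rightarrow> real ^ 'd) \<Rightarrow> 'd::finite quat \<Rightarrow> 'd mom" where
  "mu_sigma \<sigma> x = map_prod (adjoint \<sigma>) (map_prod (adjoint \<sigma>) (adjoint \<sigma>)) (torus_moment x)"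

definition translation_moment :: "'d::finite quat \<Rightarrow> 'd mom" where
  "translation_moment q = - (q1 q, q2 q, q3 q)"


section \<open>Taub-NUT deformations\<close>

definition tn_act ::
  "(real ^ 'd \<Rightarrow> real ^ 'd) \<Rightarrow> real ^ 'd \<Rightarrow> 'd::finite quat \<times> 'd quat \<Rightarrow> 'd quat \<times> 'd quat" where
  "tn_act \<sigma> t p = (torus_act (\<sigma> t) (fst p), of_coords t 0 0 0 + snd p)"

definition tn_moment :: "(real ^ 'd \<Rightarrow> real ^ 'd) \<Rightarrow> 'd::finite quat \<times> 'd quat \<Rightarrow> 'd mom" where
  "tn_moment \<sigma> p = mu_sigma \<sigma> (fst p) + translation_moment (snd p)"

definition tn_level :: "(real ^ 'd \<Rightarrow> real ^ 'd) \<Rightarrow> ('d::finite quat \<times> 'd quat) set" where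
  "tn_level \<sigma> = {p. tn_moment \<sigma> p = 0}"

definition tn_orbit ::
  "(real ^ 'd \<Rightarrow> real ^ 'd) \<Rightarrow> 'd::finite quat \<times> 'd quat \<Rightarrow> ('d quat \<times> 'd quat) set" where
  "tn_orbit \<sigma> p = range (\<lambda>t. tn_act \<sigma> t p)"

definition tn_quotient ::
  "(real ^ 'd \<Rightarrow> real ^ 'd) \<Rightarrow> ('d::finite quat \<times> 'd quat) set set" where
  "tn_quotient \<sigma> = tn_orbit \<sigma> ` tn_level \<sigma>"

text \<open>Every orbit in the level set meets the slice \<open>q0 = 0\<close> in exactly one point, and on the slice
  \<open>q1, q2, q3\<close> are determined by the first factor.  This is the natural diffeomorphism of
  \<open>'d quat\<close> with the quotient: it sends \<open>x\<close> to the orbit of \<open>tn_slice \<sigma> x\<close>, and in terms of it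
  \<open>tn_proj \<sigma>\<close> is the quotient map; see \<open>bij_betw_tn_quotient\<close> and \<open>tn_orbit_tn_proj\<close> below.\<close>

definition tn_slice :: "(real ^ 'd \<Rightarrow> real ^ 'd) \<Rightarrow> 'd::finite quat \<Rightarrow> 'd quat \<times> 'd quat" where
  "tn_slice \<sigma> x = (case mu_sigma \<sigma> x of (a, b, c) \<Rightarrow> (x, of_coords 0 a b c))"

definition tn_proj :: "(real ^ 'd \<Rightarrow> real ^ 'd) \<Rightarrow> 'd::finite quat \<times> 'd quat \<Rightarrow> 'd quat" where
  "tn_proj \<sigma> p = torus_act (\<sigma> (- q0 (snd p))) (fst p)"

text \<open>Vectors at \<open>p\<close> that are tangent to the level set and orthogonal to the orbit through \<open>p\<close>.\<close>

definition tn_horizontal ::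
  "(real ^ 'd \<Rightarrow> real ^ 'd) \<Rightarrow> 'd::finite quat \<times> 'd quat \<Rightarrow> ('d quat \<times> 'd quat) set" where
  "tn_horizontal \<sigma> p = {U. frechet_derivative (tn_moment \<sigma>) (at p) U = 0 \<and>
     (\<forall>\<tau>. orthogonal U (frechet_derivative (\<lambda>t. tn_act \<sigma> t p) (at 0) \<tau>))}"

text \<open>The quotient metric is the one for which the quotient map of the level set is a Riemannian
  submersion.  It exists and is unique by \<open>ex1_quotient_metric\<close> below.\<close>

definition is_tn_quotient_metric ::
  "(real ^ 'd \<Rightarrow> real ^ 'd) \<Rightarrow> 'd::finite quat metric_tensor \<Rightarrow> bool" where
  "is_tn_quotient_metric \<sigma> g \<longleftrightarrow>
    (\<forall>p \<in> tn_level \<sigma>. \<forall>U \<in> tn_horizontal \<sigma> p. \<forall>V \<in> tn_horizontal \<sigma> p.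
       g (tn_proj \<sigma> p) (frechet_derivative (tn_proj \<sigma>) (at p) U)
                       (frechet_derivative (tn_proj \<sigma>) (at p) V) = inner U V)"

definition g_TN :: "(real ^ 'd \<Rightarrow> real ^ 'd) \<Rightarrow> 'd::finite quat metric_tensor" where
  "g_TN \<sigma> = (THE g. is_tn_quotient_metric \<sigma> g)"


section \<open>The double quotient\<close>

definition GL_int :: "(real ^ 'd ^ 'd::finite) set" where
  "GL_int = {map_matrix real_of_int A | A :: int ^ 'd ^ 'd. invertible A}"

definition double_coset :: "real ^ 'd ^ 'd \<Rightarrow> (real ^ 'd ^ 'd::finite) set" where
  "double_coset M = {A ** M ** B | A B. A \<in> GL_int \<and> orthogonal_matrix B}"



section \<open>The quotient metric is well defined\<close>

lemma has_derivative_vec: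
  fixes f :: "'a::real_normed_vector \<Rightarrow> 'b::euclidean_space ^ 'n"
  assumes "\<And>i. ((\<lambda>x. f x $ i) has_derivative (\<lambda>h. f' h $ i)) (at x within S)"
  shows "(f has_derivative f') (at x within S)"
proof -
  have "((\<lambda>x. f x \<bullet> b) has_derivative (\<lambda>h. f' h \<bullet> b)) (at x within S)" if "b \<in> Basis" for b
  proof -
    from that obtain i u where b: "b = axis i u"
      by (auto simp: Basis_vec_def)
    show ?thesis
      unfolding b inner_axis using assms[of i] by (rule has_derivative_inner_left)
  qed
  then show ?thesis
    using has_derivative_componentwise_within[of f f' x S] by blast
qed

lemma q_of_coords [simp]:
  "q0 (of_coords a b c e) = a" "q1 (of_coords a b c e) = b"
  "q2 (of_coords a b c e) = c" "q3 (of_coords a b c e) = e"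
  by (simp_all add: q0_def q1_def q2_def q3_def of_coords_def vec_eq_iff)

lemma of_coords_q: "of_coords (q0 x) (q1 x) (q2 x) (q3 x) = x"
  by (simp add: q0_def q1_def q2_def q3_def of_coords_def vec_eq_iff prod_eq_iff complex_eq_iff)

lemma of_coords_add:
  "of_coords a b c e + of_coords a' b' c' e' = of_coords (a + a') (b + b') (c + c') (e + e')"
  by (simp add: of_coords_def vec_eq_iff prod_eq_iff complex_eq_iff)

lemma q_add [simp]:
  "q0 (x + y) = q0 x + q0 y" "q1 (x + y) = q1 x + q1 y"
  "q2 (x + y) = q2 x + q2 y" "q3 (x + y) = q3 x + q3 y"
  by (simp_all add: q0_def q1_def q2_def q3_def vec_eq_iff)

lemma linear_q0: "linear q0"
  by (rule linearI) (simp_all add: q0_def vec_eq_iff)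

lemma linear_translation_moment: "linear translation_moment"
  by (rule linearI)
    (simp_all add: translation_moment_def q1_def q2_def q3_def vec_eq_iff prod_eq_iff)

lemma torus_act_0 [simp]: "torus_act 0 x = x"
  by (simp add: torus_act_def vec_eq_iff prod_eq_iff)

lemma torus_act_add: "torus_act s (torus_act t x) = torus_act (s + t) x"
  by (simp add: torus_act_def vec_eq_iff prod_eq_iff cis_mult flip: mult.assoc)

lemma torus_act_inverse [simp]: "torus_act t (torus_act (- t) x) = x" "torus_act (- t) (torus_act t x) = x"
  by (simp_all add: torus_act_add)

lemma linear_torus_act: "linear (torus_act t)"
  by (rule linearI) (simp_all add: torus_act_def vec_eq_iff prod_eq_iff algebra_simps)

lemma inner_cis_mult: "inner (cis a * z) (cis a * w) = inner z w"
proof -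
  have "inner (cis a * z) (cis a * w) = ((cos a)\<^sup>2 + (sin a)\<^sup>2) * inner z w"
    unfolding inner_complex_def by (simp only: cis.sel times_complex.sel) algebra
  then show ?thesis by simp
qed

lemma inner_torus_act: "inner (torus_act t x) (torus_act t y) = inner x y"
  by (simp add: torus_act_def inner_prod_def inner_vec_def inner_cis_mult)

lemma torus_moment_torus_act: "torus_moment (torus_act t x) = torus_moment x"
proof -
  have "cis (- a) * z * (cis a * w) = (cis (- a) * cis a) * (z * w)" for a z w
    by (simp only: mult_ac)
  then have "cis (- a) * z * (cis a * w) = z * w" for a z w
    by (simp add: cis_mult)
  then show ?thesis
    by (simp only: torus_moment_def torus_act_def fst_conv snd_conv vec_lambda_beta norm_mult
        norm_cis mult_1)
qed

text \<open>The infinitesimal torus action.\<close>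

definition torus_inf :: "real ^ 'd \<Rightarrow> 'd::finite quat \<Rightarrow> 'd quat" where
  "torus_inf t x = (\<chi> k. - (\<i> * t $ k * fst x $ k), \<chi> k. \<i> * t $ k * snd x $ k)"

lemma torus_inf_uminus: "torus_inf (- t) x = - torus_inf t x"
  by (simp add: torus_inf_def vec_eq_iff prod_eq_iff)

lemma torus_inf_0: "torus_inf 0 x = 0"
  by (simp add: torus_inf_def vec_eq_iff prod_eq_iff)

lemma torus_act_torus_inf: "torus_act s (torus_inf t x) = torus_inf t (torus_act s x)"
  by (simp add: torus_inf_def torus_act_def vec_eq_iff prod_eq_iff)

lemma has_derivative_torus_act:
  fixes a :: "'a::real_normed_vector \<Rightarrow> real ^ 'd::finite"
  assumes a: "(a has_derivative a') (at p)" and x: "(x has_derivative x') (at p)"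
  shows "((\<lambda>p. torus_act (a p) (x p)) has_derivative
          (\<lambda>h. torus_act (a p) (x' h + torus_inf (a' h) (x p)))) (at p)"
proof -
  have a1: "((\<lambda>p. a p $ k) has_derivative (\<lambda>h. a' h $ k)) (at p)" for k
    using bounded_linear.has_derivative[OF bounded_linear_vec_nth a] .
  have x1: "((\<lambda>p. fst (x p) $ k) has_derivative (\<lambda>h. fst (x' h) $ k)) (at p)" for k
    using bounded_linear.has_derivative[OF bounded_linear_vec_nth has_derivative_fst[OF x]] .
  have x2: "((\<lambda>p. snd (x p) $ k) has_derivative (\<lambda>h. snd (x' h) $ k)) (at p)" for k
    using bounded_linear.has_derivative[OF bounded_linear_vec_nth has_derivative_snd[OF x]] .
  show ?thesis
    unfolding torus_act_def
    by (rule has_derivative_eq_rhs, rule has_derivative_Pair; (rule has_derivative_vec)?)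
      (auto intro!: derivative_eq_intros a1 x1 x2
        simp: torus_inf_def scaleR_conv_of_real algebra_simps fun_eq_iff)
qed

lemma mu_sigma_torus_act: "mu_sigma \<sigma> (torus_act t x) = mu_sigma \<sigma> x"
  by (simp add: mu_sigma_def torus_moment_torus_act)

lemma differentiable_vec:
  fixes f :: "'a::real_normed_vector \<Rightarrow> 'b::euclidean_space ^ 'n"
  assumes "\<And>i. (\<lambda>x. f x $ i) differentiable (at x)"
  shows "f differentiable (at x)"
proof -
  obtain f' where "\<And>i. ((\<lambda>x. f x $ i) has_derivative f' i) (at x)"
    using assms unfolding differentiable_def by metis
  then have "(f has_derivative (\<lambda>h. \<chi> i. f' i h)) (at x)"
    by (intro has_derivative_vec) simp
  then show ?thesis unfolding differentiable_def by blast
qed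

lemma differentiable_torus_moment: "(torus_moment :: 'd::finite quat \<Rightarrow> 'd mom) differentiable (at x)"
proof -
  have lin: "(\<lambda>x::'d quat. Re (fst x $ k)) differentiable (at x)"
    "(\<lambda>x::'d quat. Im (fst x $ k)) differentiable (at x)"
    "(\<lambda>x::'d quat. Re (snd x $ k)) differentiable (at x)"
    "(\<lambda>x::'d quat. Im (snd x $ k)) differentiable (at x)" for k x
    by (intro linear_imp_differentiable linearI; simp)+
  have sq: "(\<lambda>x. (f x)\<^sup>2) differentiable (at x)"
    if "f differentiable (at x)" for f :: "'d quat \<Rightarrow> real"
    unfolding power2_eq_square using that by (intro differentiable_mult)
  have "torus_moment = (\<lambda>x.
    (\<chi> k. ((Re (snd x $ k))\<^sup>2 + (Im (snd x $ k))\<^sup>2 - ((Re (fst x $ k))\<^sup>2 + (Im (fst x $ k))\<^sup>2)) * inverse 2,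
     \<chi> k. - (Re (fst x $ k) * Im (snd x $ k) + Im (fst x $ k) * Re (snd x $ k)),
     \<chi> k. Re (fst x $ k) * Re (snd x $ k) - Im (fst x $ k) * Im (snd x $ k)) :: 'd mom)"
    by (simp add: torus_moment_def fun_eq_iff vec_eq_iff cmod_power2)
  moreover have "\<dots> differentiable (at x)"
    by (intro differentiable_Pair differentiable_vec; simp only: vec_lambda_beta;
        intro differentiable_mult differentiable_add differentiable_diff differentiable_minus sq
          lin differentiable_const)
  ultimately show ?thesis by simp
qed

lemma linear_adjoint3:
  fixes \<sigma> :: "real ^ 'd \<Rightarrow> real ^ 'd::finite"
  assumes "linear \<sigma>"
  shows "linear (map_prod (adjoint \<sigma>) (map_prod (adjoint \<sigma>) (adjoint \<sigma>)))"
  using adjoint_linear[OF assms]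
  by (auto intro!: linearI simp: linear_add linear_scale)

lemma tn_moment_has_derivative:
  fixes \<sigma> :: "real ^ 'd \<Rightarrow> real ^ 'd::finite"
  assumes "linear \<sigma>"
  shows "(tn_moment \<sigma> has_derivative
    (\<lambda>U. frechet_derivative (mu_sigma \<sigma>) (at (fst p)) (fst U) + translation_moment (snd U))) (at p)"
proof -
  have "mu_sigma \<sigma> = map_prod (adjoint \<sigma>) (map_prod (adjoint \<sigma>) (adjoint \<sigma>)) \<circ> torus_moment"
    by (simp add: mu_sigma_def fun_eq_iff)
  then have "mu_sigma \<sigma> differentiable (at x)" for x
    using differentiable_chain_at[OF differentiable_torus_moment
        linear_imp_differentiable[OF linear_adjoint3[OF assms]]] by metis
  then have "(mu_sigma \<sigma> has_derivative frechet_derivative (mu_sigma \<sigma>) (at x)) (at x)" for x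
    by (simp flip: frechet_derivative_works)
  from diff_chain_at[OF _ this, of fst fst p]
  have 1: "((\<lambda>p. mu_sigma \<sigma> (fst p)) has_derivative
      (\<lambda>U. frechet_derivative (mu_sigma \<sigma>) (at (fst p)) (fst U))) (at p)"
    using has_derivative_fst[OF has_derivative_ident] by (auto simp: o_def)
  have "linear (\<lambda>U :: 'd quat \<times> 'd quat. translation_moment (snd U))"
    using linear_compose[OF linear_snd linear_translation_moment] by (simp add: o_def)
  then have 2: "((\<lambda>U :: 'd quat \<times> 'd quat. translation_moment (snd U)) has_derivative
      (\<lambda>U. translation_moment (snd U))) (at p)"
    by (rule linear_imp_has_derivative)
  show ?thesis
    unfolding tn_moment_def[abs_def] by (intro has_derivative_add 1 2)
qed

lemma tn_proj_has_derivative: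
  fixes \<sigma> :: "real ^ 'd \<Rightarrow> real ^ 'd::finite"
  assumes "linear \<sigma>"
  shows "(tn_proj \<sigma> has_derivative
    (\<lambda>U. torus_act (\<sigma> (- q0 (snd p))) (fst U + torus_inf (\<sigma> (- q0 (snd U))) (fst p)))) (at p)"
proof -
  have "linear (\<lambda>p :: 'd quat \<times> 'd quat. \<sigma> (- q0 (snd p)))"
    by (rule linearI)
      (simp_all add: linear_add[OF linear_q0] linear_scale[OF linear_q0] linear_neg[OF assms]
        linear_diff[OF assms] linear_add[OF assms] linear_scale[OF assms])
  from has_derivative_torus_act[OF linear_imp_has_derivative[OF this]
      has_derivative_fst[OF has_derivative_ident]]
  show ?thesis
    unfolding tn_proj_def[abs_def] .
qed

lemma tn_act_has_derivative_0:
  fixes \<sigma> :: "real ^ 'd \<Rightarrow> real ^ 'd::finite"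
  assumes "linear \<sigma>"
  shows "((\<lambda>t. tn_act \<sigma> t p) has_derivative
    (\<lambda>\<tau>. (torus_inf (\<sigma> \<tau>) (fst p), of_coords \<tau> 0 0 0))) (at 0)"
proof -
  have 1: "((\<lambda>t. torus_act (\<sigma> t) (fst p)) has_derivative (\<lambda>\<tau>. torus_inf (\<sigma> \<tau>) (fst p))) (at 0)"
    using has_derivative_torus_act[OF linear_imp_has_derivative[OF assms] has_derivative_const,
        of "fst p" 0]
    by (simp add: linear_0[OF assms])
  have "linear (\<lambda>t :: real ^ 'd. of_coords t 0 0 0)"
    by (rule linearI) (simp_all add: of_coords_def vec_eq_iff prod_eq_iff complex_eq_iff)
  from linear_imp_has_derivative[OF this]
  have 2: "((\<lambda>t. of_coords t 0 0 0 + snd p) has_derivative (\<lambda>\<tau>. of_coords \<tau> 0 0 0)) (at 0)"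
    by (auto intro!: derivative_eq_intros)
  show ?thesis
    unfolding tn_act_def by (intro has_derivative_Pair 1 2)
qed

lemma tn_moment_tn_act: "tn_moment \<sigma> (tn_act \<sigma> t p) = tn_moment \<sigma> p"
  by (simp add: tn_moment_def tn_act_def mu_sigma_torus_act translation_moment_def)

lemma tn_proj_tn_act:
  assumes "linear \<sigma>"
  shows "tn_proj \<sigma> (tn_act \<sigma> t p) = tn_proj \<sigma> p"
proof -
  have "\<sigma> (- q0 (of_coords t 0 0 0 + snd p)) + \<sigma> t = \<sigma> (- q0 (snd p))"
    by (simp flip: linear_add[OF assms])
  then show ?thesis
    by (simp only: tn_proj_def tn_act_def fst_conv snd_conv torus_act_add)
qed

lemma tn_act_0:
  assumes "linear \<sigma>"
  shows "tn_act \<sigma> 0 p = p"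
  by (simp add: tn_act_def linear_0[OF assms]) (simp add: of_coords_def prod_eq_iff vec_eq_iff complex_eq_iff)

lemma tn_act_add:
  assumes "linear \<sigma>"
  shows "tn_act \<sigma> s (tn_act \<sigma> t p) = tn_act \<sigma> (s + t) p"
proof -
  have "of_coords s 0 0 0 + (of_coords t 0 0 0 + snd p) = of_coords (s + t) 0 0 0 + snd p"
    by (simp only: of_coords_add add_0 flip: add.assoc)
  then show ?thesis
    by (simp only: tn_act_def fst_conv snd_conv torus_act_add linear_add[OF assms])
qed

lemma tn_slice_in_tn_level: "tn_slice \<sigma> x \<in> tn_level \<sigma>"
  by (simp add: tn_level_def tn_moment_def tn_slice_def translation_moment_def zero_prod_def
      split: prod.split)

lemma tn_proj_tn_slice:
  assumes "linear \<sigma>"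
  shows "tn_proj \<sigma> (tn_slice \<sigma> x) = x"
  by (simp add: tn_proj_def tn_slice_def linear_0[OF assms] split: prod.split)

lemma tn_act_tn_slice_tn_proj:
  assumes "linear \<sigma>" and "p \<in> tn_level \<sigma>"
  shows "tn_act \<sigma> (q0 (snd p)) (tn_slice \<sigma> (tn_proj \<sigma> p)) = p"
proof -
  have mu: "mu_sigma \<sigma> (fst p) = (q1 (snd p), q2 (snd p), q3 (snd p))"
    using assms(2) by (simp add: tn_level_def tn_moment_def translation_moment_def
        add_eq_0_iff2)
  show ?thesis
    by (simp add: tn_act_def tn_slice_def tn_proj_def mu_sigma_torus_act mu torus_act_add
        linear_neg[OF assms(1)] of_coords_add of_coords_q)
qed

lemma tn_orbit_tn_act:
  assumes "linear \<sigma>"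
  shows "tn_orbit \<sigma> (tn_act \<sigma> t p) = tn_orbit \<sigma> p"
proof -
  have "tn_orbit \<sigma> (tn_act \<sigma> t p) = (\<lambda>s. tn_act \<sigma> s p) ` range (\<lambda>s. s + t)"
    unfolding tn_orbit_def tn_act_add[OF assms] image_image ..
  also have "range (\<lambda>s. s + t) = UNIV"
    by (rule surjI[of _ "\<lambda>s. s - t"]) simp
  finally show ?thesis
    unfolding tn_orbit_def .
qed

lemma tn_orbit_tn_proj:
  assumes "linear \<sigma>" and "p \<in> tn_level \<sigma>"
  shows "tn_orbit \<sigma> (tn_slice \<sigma> (tn_proj \<sigma> p)) = tn_orbit \<sigma> p"
  using tn_orbit_tn_act[OF assms(1), of "q0 (snd p)" "tn_slice \<sigma> (tn_proj \<sigma> p)"]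
  unfolding tn_act_tn_slice_tn_proj[OF assms] by (rule sym)

lemma bij_betw_tn_quotient:
  assumes "linear \<sigma>"
  shows "bij_betw (\<lambda>x. tn_orbit \<sigma> (tn_slice \<sigma> x)) UNIV (tn_quotient \<sigma>)"
proof (rule bij_betw_imageI)
  show "inj (\<lambda>x. tn_orbit \<sigma> (tn_slice \<sigma> x))"
  proof (rule injI)
    fix x y
    assume "tn_orbit \<sigma> (tn_slice \<sigma> x) = tn_orbit \<sigma> (tn_slice \<sigma> y)"
    then have "tn_act \<sigma> 0 (tn_slice \<sigma> x) \<in> tn_orbit \<sigma> (tn_slice \<sigma> y)"
      unfolding tn_orbit_def by blast
    then obtain t where "tn_slice \<sigma> x = tn_act \<sigma> t (tn_slice \<sigma> y)"
      unfolding tn_orbit_def tn_act_0[OF assms] by blast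
    then show "x = y"
      by (metis tn_proj_tn_act[OF assms] tn_proj_tn_slice[OF assms])
  qed
  show "range (\<lambda>x. tn_orbit \<sigma> (tn_slice \<sigma> x)) = tn_quotient \<sigma>"
  proof (rule equalityI; rule subsetI)
    fix A
    assume "A \<in> range (\<lambda>x. tn_orbit \<sigma> (tn_slice \<sigma> x))"
    then show "A \<in> tn_quotient \<sigma>"
      unfolding tn_quotient_def using tn_slice_in_tn_level by blast
  next
    fix A
    assume "A \<in> tn_quotient \<sigma>"
    then obtain p where "p \<in> tn_level \<sigma>" "A = tn_orbit \<sigma> p"
      unfolding tn_quotient_def by blast
    with tn_orbit_tn_proj[OF assms, of p] show "A \<in> range (\<lambda>x. tn_orbit \<sigma> (tn_slice \<sigma> x))"
      by (metis rangeI)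
  qed
qed

lemma tn_horizontal_iff:
  fixes \<sigma> :: "real ^ 'd \<Rightarrow> real ^ 'd::finite"
  assumes "linear \<sigma>"
  shows "U \<in> tn_horizontal \<sigma> p \<longleftrightarrow> frechet_derivative (tn_moment \<sigma>) (at p) U = 0 \<and>
    (\<forall>\<tau>. orthogonal U (torus_inf (\<sigma> \<tau>) (fst p), of_coords \<tau> 0 0 0))"
  using frechet_derivative_at[OF tn_act_has_derivative_0[OF assms, of p], symmetric]
  by (simp add: tn_horizontal_def)

lemma tn_invariant_derivative:
  fixes \<sigma> :: "real ^ 'd \<Rightarrow> real ^ 'd::finite" and F :: "'d quat \<times> 'd quat \<Rightarrow> 'c::real_normed_vector"
  assumes lin: "linear \<sigma>" and inv: "\<And>t p. F (tn_act \<sigma> t p) = F p"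
    and diff: "\<And>p. F differentiable (at p)"
  shows "frechet_derivative F (at (tn_act \<sigma> t p)) (torus_act (\<sigma> t) (fst U), snd U) =
      frechet_derivative F (at p) U"
    and "frechet_derivative F (at p) (torus_inf (\<sigma> \<tau>) (fst p), of_coords \<tau> 0 0 0) = 0"
proof -
  have D: "(F has_derivative frechet_derivative F (at p)) (at p)" for p
    using diff by (simp flip: frechet_derivative_works)
  have "((\<lambda>p. torus_act (\<sigma> t) (fst p)) has_derivative (\<lambda>U. torus_act (\<sigma> t) (fst U))) (at p)"
    for p :: "'d quat \<times> 'd quat"
    using linear_imp_has_derivative[OF linear_compose[OF linear_fst linear_torus_act]]
    by (simp add: o_def)
  then have A: "(tn_act \<sigma> t has_derivative (\<lambda>U. (torus_act (\<sigma> t) (fst U), snd U))) (at p)"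
    unfolding tn_act_def[abs_def]
    using has_derivative_add[OF has_derivative_const has_derivative_snd[OF has_derivative_ident]]
    by (intro has_derivative_Pair) simp_all
  have "F \<circ> tn_act \<sigma> t = F"
    using inv by (simp add: fun_eq_iff)
  with diff_chain_at[OF A D] have "(F has_derivative
      frechet_derivative F (at (tn_act \<sigma> t p)) \<circ> (\<lambda>U. (torus_act (\<sigma> t) (fst U), snd U))) (at p)"
    by simp
  from has_derivative_unique[OF this D]
  show "frechet_derivative F (at (tn_act \<sigma> t p)) (torus_act (\<sigma> t) (fst U), snd U) =
      frechet_derivative F (at p) U"
    by (simp only: fun_eq_iff o_apply)
  have "F \<circ> (\<lambda>t. tn_act \<sigma> t p) = (\<lambda>t. F p)"
    using inv by (simp add: fun_eq_iff)
  with diff_chain_at[OF tn_act_has_derivative_0[OF lin, of p] D]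
  have "((\<lambda>t. F p) has_derivative frechet_derivative F (at p) \<circ>
      (\<lambda>\<tau>. (torus_inf (\<sigma> \<tau>) (fst p), of_coords \<tau> 0 0 0))) (at 0)"
    by (simp add: tn_act_0[OF lin])
  from has_derivative_unique[OF this has_derivative_const]
  show "frechet_derivative F (at p) (torus_inf (\<sigma> \<tau>) (fst p), of_coords \<tau> 0 0 0) = 0"
    by (simp add: fun_eq_iff)
qed

lemma tn_differentiable:
  fixes \<sigma> :: "real ^ 'd \<Rightarrow> real ^ 'd::finite"
  assumes "linear \<sigma>"
  shows "tn_moment \<sigma> differentiable (at p)" "tn_proj \<sigma> differentiable (at p)"
  by (rule differentiableI[OF tn_moment_has_derivative[OF assms]])
    (rule differentiableI[OF tn_proj_has_derivative[OF assms]])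

lemma tn_horizontal_lift:
  fixes \<sigma> :: "real ^ 'd \<Rightarrow> real ^ 'd::finite"
  assumes lin: "linear \<sigma>"
  shows "\<exists>!U. U \<in> tn_horizontal \<sigma> p \<and> frechet_derivative (tn_proj \<sigma>) (at p) U = u"
proof -
  define X where "X \<tau> = (torus_inf (\<sigma> \<tau>) (fst p), of_coords \<tau> 0 0 0)" for \<tau>
  define M where "M = frechet_derivative (tn_moment \<sigma>) (at p)"
  define P where "P = frechet_derivative (tn_proj \<sigma>) (at p)"
  define N where "N = frechet_derivative (mu_sigma \<sigma>) (at (fst p))"
  have M: "M U = N (fst U) + translation_moment (snd U)" for U
    using frechet_derivative_at[OF tn_moment_has_derivative[OF lin, of p], symmetric]
    by (simp add: M_def N_def)
  have P: "P U = torus_act (\<sigma> (- q0 (snd p))) (fst U + torus_inf (\<sigma> (- q0 (snd U))) (fst p))" for U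
    using frechet_derivative_at[OF tn_proj_has_derivative[OF lin, of p], symmetric]
    by (simp add: P_def)
  have linM: "linear M" and linP: "linear P"
    unfolding M_def P_def by (intro linear_frechet_derivative tn_differentiable lin)+
  have MX: "M (X \<tau>) = 0" and PX: "P (X \<tau>) = 0" for \<tau>
    unfolding M_def P_def X_def
    by (intro tn_invariant_derivative lin tn_moment_tn_act tn_proj_tn_act tn_differentiable)+
  have linX: "linear X"
    using has_derivative_linear[OF tn_act_has_derivative_0[OF lin, of p]]
    unfolding X_def[abs_def] .
  have hor: "U \<in> tn_horizontal \<sigma> p \<longleftrightarrow> M U = 0 \<and> (\<forall>\<tau>. orthogonal U (X \<tau>))" for U
    by (simp add: tn_horizontal_iff[OF lin] M_def X_def)
  have "N 0 = 0"
    using M[of 0] by (simp add: linear_0[OF linM] linear_0[OF linear_translation_moment])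
  define \<xi> where "\<xi> = torus_act (\<sigma> (q0 (snd p))) u"
  obtain a b c where abc: "N \<xi> = (a, b, c)"
    by (cases "N \<xi>") auto
  define U0 where "U0 = (\<xi>, of_coords 0 a b c)"
  have "M U0 = 0"
    by (simp add: M U0_def abc translation_moment_def zero_prod_def)
  have "P U0 = u"
    by (simp add: P U0_def \<xi>_def linear_0[OF lin] linear_neg[OF lin] torus_inf_0)
  obtain Y Z where Y: "Y \<in> span (range X)" and Z: "\<And>w. w \<in> span (range X) \<Longrightarrow> orthogonal Z w"
    and U0: "U0 = Y + Z"
    using orthogonal_subspace_decomp_exists by blast
  have "span (range X) = range X"
    using linear_subspace_image[OF linX subspace_UNIV] by (simp add: span_eq_iff)
  with Y obtain \<tau> where \<tau>: "Y = X \<tau>" by auto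
  have "M Z = 0"
    using \<open>M U0 = 0\<close> MX[of \<tau>] by (simp add: U0 \<tau> linear_add[OF linM])
  moreover have "P Z = u"
    using \<open>P U0 = u\<close> PX[of \<tau>] by (simp add: U0 \<tau> linear_add[OF linP])
  moreover have "orthogonal Z (X \<tau>)" for \<tau>
    by (rule Z) (simp add: span_base)
  ultimately have ex: "Z \<in> tn_horizontal \<sigma> p \<and> P Z = u"
    by (simp add: hor)
  have "U = U'" if "U \<in> tn_horizontal \<sigma> p" "P U = u" "U' \<in> tn_horizontal \<sigma> p" "P U' = u" for U U'
  proof -
    define W where "W = U - U'"
    define \<tau> where "\<tau> = q0 (snd W)"
    have MW: "M W = 0" and PW: "P W = 0" and W: "orthogonal W (X t)" for t
      using that by (auto simp: hor W_def linear_diff[OF linM] linear_diff[OF linP] orthogonal_def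
          inner_diff_left)
    have "torus_act (\<sigma> (q0 (snd p))) (P W) = 0"
      by (simp add: PW linear_0[OF linear_torus_act])
    then have W1: "fst W = torus_inf (\<sigma> \<tau>) (fst p)"
      by (simp add: P torus_act_add linear_neg[OF lin] torus_inf_uminus \<tau>_def)
    have "fst (W - X \<tau>) = 0"
      by (simp add: W1 X_def)
    moreover have "M (W - X \<tau>) = 0"
      by (simp add: linear_diff[OF linM] MW MX)
    ultimately have "translation_moment (snd (W - X \<tau>)) = 0"
      using M[of "W - X \<tau>"] \<open>N 0 = 0\<close> by simp
    then have "q1 (snd (W - X \<tau>)) = 0" "q2 (snd (W - X \<tau>)) = 0" "q3 (snd (W - X \<tau>)) = 0"
      by (auto simp: translation_moment_def zero_prod_def)
    moreover have "q0 (snd (W - X \<tau>)) = 0"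
      by (simp add: linear_diff[OF linear_q0] X_def \<tau>_def)
    ultimately have "snd (W - X \<tau>) = of_coords 0 0 0 0"
      by (metis of_coords_q)
    then have "snd (W - X \<tau>) = 0"
      by (simp only: of_coords_def) (simp add: vec_eq_iff prod_eq_iff complex_eq_iff)
    with \<open>fst (W - X \<tau>) = 0\<close> have "W = X \<tau>"
      by (simp add: prod_eq_iff)
    with W[of \<tau>] have "W = 0"
      by (simp add: orthogonal_self)
    then show ?thesis
      by (simp add: W_def)
  qed
  with ex show ?thesis
    unfolding P_def by blast
qed

lemma tn_horizontal_tn_act:
  fixes \<sigma> :: "real ^ 'd \<Rightarrow> real ^ 'd::finite"
  assumes lin: "linear \<sigma>" and "U \<in> tn_horizontal \<sigma> p"
  shows "(torus_act (\<sigma> t) (fst U), snd U) \<in> tn_horizontal \<sigma> (tn_act \<sigma> t p)"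
proof -
  have fstA: "fst (tn_act \<sigma> t p) = torus_act (\<sigma> t) (fst p)"
    by (simp add: tn_act_def)
  have "orthogonal (torus_act (\<sigma> t) (fst U), snd U) (torus_act (\<sigma> t) v, w) = orthogonal U (v, w)"
    for v w
    by (cases U) (simp only: orthogonal_def inner_Pair inner_torus_act fst_conv snd_conv)
  then show ?thesis
    using assms(2)
    by (simp add: tn_horizontal_iff[OF lin] tn_invariant_derivative(1)[OF lin tn_moment_tn_act
          tn_differentiable(1)[OF lin]] fstA flip: torus_act_torus_inf)
qed

theorem ex1_quotient_metric:
  fixes \<sigma> :: "real ^ 'd \<Rightarrow> real ^ 'd::finite"
  assumes lin: "linear \<sigma>"
  shows "\<exists>!g. is_tn_quotient_metric \<sigma> g"
proof -
  define D where "D p = frechet_derivative (tn_proj \<sigma>) (at p)" for p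
  define L where "L x u = (THE U. U \<in> tn_horizontal \<sigma> (tn_slice \<sigma> x) \<and> D (tn_slice \<sigma> x) U = u)"
    for x u
  have L: "L x u \<in> tn_horizontal \<sigma> (tn_slice \<sigma> x)" "D (tn_slice \<sigma> x) (L x u) = u" for x u
    using theI'[OF tn_horizontal_lift[OF lin, of "tn_slice \<sigma> x" u]] by (auto simp: L_def D_def)
  have U_eq: "U = (torus_act (\<sigma> (q0 (snd p))) (fst V), snd V)"
    if p: "p \<in> tn_level \<sigma>" and U: "U \<in> tn_horizontal \<sigma> p" and V: "V = L (tn_proj \<sigma> p) (D p U)" for p U V
  proof -
    let ?x = "tn_slice \<sigma> (tn_proj \<sigma> p)" and ?t = "q0 (snd p)"
    let ?W = "(torus_act (\<sigma> ?t) (fst V), snd V)"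
    have p_eq: "tn_act \<sigma> ?t ?x = p"
      by (rule tn_act_tn_slice_tn_proj[OF lin p])
    have "?W \<in> tn_horizontal \<sigma> p"
      using tn_horizontal_tn_act[OF lin, of V ?x ?t] L(1) by (simp add: p_eq V)
    moreover have "D p ?W = D p U"
      using tn_invariant_derivative(1)[OF lin tn_proj_tn_act[OF lin] tn_differentiable(2)[OF lin], of ?t ?x V]
      by (simp only: p_eq V L(2)[unfolded D_def] D_def)
    ultimately show ?thesis
      using tn_horizontal_lift[OF lin, of p "D p U"] U unfolding D_def by blast
  qed
  show ?thesis
  proof (rule ex1I)
    show "is_tn_quotient_metric \<sigma> (\<lambda>x u v. inner (L x u) (L x v))"
      unfolding is_tn_quotient_metric_def
    proof (intro ballI)
      fix p U V
      assume p: "p \<in> tn_level \<sigma>" and U: "U \<in> tn_horizontal \<sigma> p" and V: "V \<in> tn_horizontal \<sigma> p"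
      define a b where "a = L (tn_proj \<sigma> p) (D p U)" and "b = L (tn_proj \<sigma> p) (D p V)"
      have "inner U V = inner a b"
        unfolding inner_prod_def[of a b] U_eq[OF p U a_def] U_eq[OF p V b_def]
        by (simp only: inner_Pair inner_torus_act)
      then show "inner (L (tn_proj \<sigma> p) (frechet_derivative (tn_proj \<sigma>) (at p) U))
          (L (tn_proj \<sigma> p) (frechet_derivative (tn_proj \<sigma>) (at p) V)) = inner U V"
        by (simp only: a_def b_def D_def)
    qed
  next
    fix g
    assume g: "is_tn_quotient_metric \<sigma> g"
    have "g x u v = inner (L x u) (L x v)" for x u v
    proof -
      have "g (tn_proj \<sigma> (tn_slice \<sigma> x)) (D (tn_slice \<sigma> x) (L x u)) (D (tn_slice \<sigma> x) (L x v)) =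
          inner (L x u) (L x v)"
        using g L(1) tn_slice_in_tn_level unfolding is_tn_quotient_metric_def D_def by blast
      then show ?thesis
        by (simp only: L(2) tn_proj_tn_slice[OF lin])
    qed
    then show "g = (\<lambda>x u v. inner (L x u) (L x v))"
      by (intro ext)
  qed
qed

lemma g_TN_submersion:
  fixes \<sigma> :: "real ^ 'd \<Rightarrow> real ^ 'd::finite"
  assumes "linear \<sigma>"
  shows "is_tn_quotient_metric \<sigma> (g_TN \<sigma>)"
  unfolding g_TN_def by (rule theI'[OF ex1_quotient_metric[OF assms]])

end

theory Submission
  imports Defs
begin

text \<open>Far from the origin in all coordinates, the quotient metric of \<open>\<sigma>\<close> is close to that of the
  product of a Euclidean space with the flat torus with period lattice \<open>inv \<sigma>\<close> of \<open>2 * pi\<close> times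
  the integral vectors, and the double coset of \<open>\<sigma>\<close> is the isometry class of that torus.  An
  isometry takes some far point \<open>q\<close> to a far point.  Lifting phases over a convex cover of a
  neighbourhood of the torus orbit of \<open>q\<close>, it induces a homomorphism of period lattices.  Speed
  bounds for the phases of the images of torus orbits, under the isometry and under its inverse, show
  that this homomorphism is invertible and preserves lengths up to a factor \<open>1 + \<epsilon>\<close> on a finite
  test set.  The candidates form a finite set of integral matrices, so one of them is an exact
  isometry of lattices.\<close>

section \<open>The quotient metric as a minimum over lifts\<close>

text \<open>An isometry is not assumed to respect the torus action, the moment maps or the origin,
  so only coarse consequences of the metric formula are available: moment maps are Lipschitz, torus
  directions have at most their lattice length at every point, and the phase relative to a far point
  turns, in lattice length, at most slightly faster than a curve moves. The bounds on moment
  displacements do not depend on the far point, so the distance \<open>Y\<close> can be fixed after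
  all of them. The tube must be thick enough for the pulled-back target loops, and this thickness
  grows with their length. Hence preimages under the lattice homomorphism are found only for
  finitely many prescribed vectors at a time, and the homomorphism may change with \<epsilon>. Axis
  vectors among them give invertibility, since a right inverse of a square integral matrix is
  two-sided; axis vectors and their pairwise sums give the Gram matrix. Finiteness of the set of
  candidates replaces a limit of varying homomorphisms.\<close>

lemma torus_inf_diff: "torus_inf (s - t) x = torus_inf s x - torus_inf t x"
  by (simp add: torus_inf_def vec_eq_iff prod_eq_iff algebra_simps)

lemma norm_of_coords_power2:
  "(norm (of_coords a b c e))\<^sup>2 = (norm a)\<^sup>2 + (norm (b, c, e))\<^sup>2"
  unfolding power2_norm_eq_inner
  by (simp add: of_coords_def inner_prod_def inner_vec_def inner_complex_def sum.distrib)

lemma mu_sigma_has_derivative: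
  assumes "linear \<sigma>"
  shows "(mu_sigma \<sigma> has_derivative frechet_derivative (mu_sigma \<sigma>) (at x)) (at x)"
proof -
  have "mu_sigma \<sigma> = map_prod (adjoint \<sigma>) (map_prod (adjoint \<sigma>) (adjoint \<sigma>)) \<circ> torus_moment"
    by (simp add: mu_sigma_def fun_eq_iff)
  then have "mu_sigma \<sigma> differentiable (at x)"
    using differentiable_chain_at[OF differentiable_torus_moment
        linear_imp_differentiable[OF linear_adjoint3[OF assms]]] by metis
  then show ?thesis
    by (simp flip: frechet_derivative_works)
qed

text \<open>Squared Euclidean length of the lift of \<open>u\<close> whose translation part has real
  component \<open>\<tau>\<close>. Tangency to the level set forces the other three translation
  components to equal the derivative of \<open>mu_sigma\<close>, hence the first summand.\<close>

definition lift_energy ::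
  "(real ^ 'd \<Rightarrow> real ^ 'd) \<Rightarrow> 'd::finite quat \<Rightarrow> 'd quat \<Rightarrow> real ^ 'd \<Rightarrow> real" where
  "lift_energy \<sigma> x u \<tau> = (norm (frechet_derivative (mu_sigma \<sigma>) (at x) u))\<^sup>2 +
     (norm (u + torus_inf (\<sigma> \<tau>) x))\<^sup>2 + (norm \<tau>)\<^sup>2"

text \<open>The lifts of \<open>u\<close> to the slice point over \<open>x\<close> differ by vectors tangent to the orbit, and
  the horizontal lift is the shortest one.\<close>

lemma
  fixes \<sigma> :: "real ^ 'd \<Rightarrow> real ^ 'd::finite"
  assumes lin: "linear \<sigma>"
  shows g_TN_eq_lift_energy: "\<exists>\<tau>. g_TN \<sigma> x u u = lift_energy \<sigma> x u \<tau>"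
    and g_TN_le_lift_energy: "g_TN \<sigma> x u u \<le> lift_energy \<sigma> x u \<tau>'"
proof -
  define p where "p = tn_slice \<sigma> x"
  define N where "N = frechet_derivative (mu_sigma \<sigma>) (at x)"
  define X where "X \<tau> = (torus_inf (\<sigma> \<tau>) x, of_coords \<tau> 0 0 0)" for \<tau>
  have p: "p \<in> tn_level \<sigma>" "tn_proj \<sigma> p = x" "fst p = x" "q0 (snd p) = 0"
    unfolding p_def by (rule tn_slice_in_tn_level, rule tn_proj_tn_slice[OF lin])
      (simp_all add: tn_slice_def split: prod.split)
  obtain U where U: "U \<in> tn_horizontal \<sigma> p" "frechet_derivative (tn_proj \<sigma>) (at p) U = u"
    using tn_horizontal_lift[OF lin, of p u] by blast
  have g: "g_TN \<sigma> x u u = (norm U)\<^sup>2"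
    using g_TN_submersion[OF lin] p(1) U
    unfolding is_tn_quotient_metric_def power2_norm_eq_inner p(2)[symmetric] by blast
  define \<tau>0 where "\<tau>0 = q0 (snd U)"
  have linN: "linear N"
    unfolding N_def using mu_sigma_has_derivative[OF lin] by (rule has_derivative_linear)
  have M: "frechet_derivative (tn_moment \<sigma>) (at p) V = N (fst V) + translation_moment (snd V)" for V
    using frechet_derivative_at[OF tn_moment_has_derivative[OF lin, of p], symmetric]
    by (simp add: N_def p)
  have "frechet_derivative (tn_moment \<sigma>) (at p) (X \<tau>) = 0" for \<tau>
    using tn_invariant_derivative(2)[OF lin tn_moment_tn_act tn_differentiable(1)[OF lin], of p \<tau>]
    by (simp add: X_def p)
  then have NX: "N (torus_inf (\<sigma> \<tau>) x) = 0" for \<tau>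
    by (simp add: M X_def translation_moment_def zero_prod_def)
  have "torus_act 0 (fst U + torus_inf (\<sigma> (- \<tau>0)) x) = u"
    using frechet_derivative_at[OF tn_proj_has_derivative[OF lin, of p], symmetric] U(2)
    by (simp add: p \<tau>0_def linear_0[OF lin])
  then have U1: "fst U = u + torus_inf (\<sigma> \<tau>0) x"
    by (simp add: linear_neg[OF lin] torus_inf_uminus algebra_simps)
  have hor: "N (fst U) + translation_moment (snd U) = 0" "orthogonal U (X \<tau>)" for \<tau>
    using U(1) by (simp_all add: tn_horizontal_iff[OF lin] M X_def p)
  have Nu: "N u = (q1 (snd U), q2 (snd U), q3 (snd U))"
    using hor(1) by (simp add: U1 linear_add[OF linN] NX translation_moment_def add_eq_0_iff2)
  have "(norm (snd U))\<^sup>2 = (norm \<tau>0)\<^sup>2 + (norm (N u))\<^sup>2"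
    using norm_of_coords_power2[of \<tau>0] by (metis Nu \<tau>0_def of_coords_q)
  moreover have "(norm U)\<^sup>2 = (norm (fst U))\<^sup>2 + (norm (snd U))\<^sup>2"
    by (simp add: norm_prod_def)
  ultimately have energy0: "(norm U)\<^sup>2 = lift_energy \<sigma> x u \<tau>0"
    by (simp add: U1 lift_energy_def N_def)
  show "\<exists>\<tau>. g_TN \<sigma> x u u = lift_energy \<sigma> x u \<tau>"
    by (intro exI[of _ \<tau>0]) (simp add: g energy0)
  define V where "V = U + X (\<tau>' - \<tau>0)"
  have "fst V = u + torus_inf (\<sigma> \<tau>') x"
    by (simp add: V_def X_def U1 linear_diff[OF lin] torus_inf_diff)
  moreover have "snd V = of_coords \<tau>' (q1 (snd U)) (q2 (snd U)) (q3 (snd U))"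
  proof -
    have "snd V = of_coords \<tau>0 (q1 (snd U)) (q2 (snd U)) (q3 (snd U)) + of_coords (\<tau>' - \<tau>0) 0 0 0"
      by (simp add: V_def X_def \<tau>0_def of_coords_q)
    then show ?thesis
      by (simp add: of_coords_add)
  qed
  moreover have "(norm V)\<^sup>2 = (norm (fst V))\<^sup>2 + (norm (snd V))\<^sup>2"
    by (simp add: norm_prod_def)
  ultimately have "(norm V)\<^sup>2 = lift_energy \<sigma> x u \<tau>'"
    by (simp add: lift_energy_def norm_of_coords_power2 Nu N_def[symmetric])
  moreover have "(norm V)\<^sup>2 = (norm U)\<^sup>2 + (norm (X (\<tau>' - \<tau>0)))\<^sup>2"
    unfolding V_def using hor(2) by (rule norm_add_Pythagorean)
  ultimately show "g_TN \<sigma> x u u \<le> lift_energy \<sigma> x u \<tau>'"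
    unfolding g using zero_le_power2[of "norm (X (\<tau>' - \<tau>0))"] by linarith
qed

lemma mu_sigma_derivative_torus_inf:
  fixes \<sigma> :: "real ^ 'd \<Rightarrow> real ^ 'd::finite"
  assumes "linear \<sigma>"
  shows "frechet_derivative (mu_sigma \<sigma>) (at x) (torus_inf s x) = 0"
proof -
  have "((\<lambda>t. torus_act t x) has_derivative (\<lambda>s. torus_inf s x)) (at 0)"
    using has_derivative_torus_act[OF has_derivative_ident has_derivative_const, of x 0] by simp
  then have "(mu_sigma \<sigma> \<circ> (\<lambda>t. torus_act t x) has_derivative
      frechet_derivative (mu_sigma \<sigma>) (at x) \<circ> (\<lambda>s. torus_inf s x)) (at 0)"
    using mu_sigma_has_derivative[OF assms, of x] by (intro diff_chain_at) simp_all
  moreover have "mu_sigma \<sigma> \<circ> (\<lambda>t. torus_act t x) = (\<lambda>t. mu_sigma \<sigma> x)"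
    by (simp add: fun_eq_iff mu_sigma_torus_act)
  ultimately show ?thesis
    using has_derivative_unique[OF _ has_derivative_const] by (fastforce simp: fun_eq_iff)
qed

text \<open>The derivative of the moment map is one summand of the energy of every lift, so
  \<open>mu_sigma\<close> is 1-Lipschitz for the quotient metric. This confines the moments along
  curves of known speed.\<close>

lemma norm_mu_sigma_derivative_le:
  fixes \<sigma> :: "real ^ 'd \<Rightarrow> real ^ 'd::finite"
  assumes "linear \<sigma>" "g_TN \<sigma> x u u \<le> l\<^sup>2" "0 \<le> l"
  shows "norm (frechet_derivative (mu_sigma \<sigma>) (at x) u) \<le> l"
proof -
  obtain \<tau> where "g_TN \<sigma> x u u = lift_energy \<sigma> x u \<tau>"
    using g_TN_eq_lift_energy[OF assms(1)] by blast
  then have "(norm (frechet_derivative (mu_sigma \<sigma>) (at x) u))\<^sup>2 \<le> l\<^sup>2"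
    using assms(2) by (simp add: lift_energy_def) (smt (verit) zero_le_power2)
  then show ?thesis
    using assms(3) by (rule power2_le_imp_le)
qed

text \<open>The competitor with real part \<open>- \<tau>\<close> cancels the torus direction and
  leaves pure translation. This is where the norm of \<open>inv \<sigma>\<close> on the lattice
  enters, with no dependence on \<open>x\<close>.\<close>

lemma g_TN_torus_inf_le:
  fixes \<sigma> :: "real ^ 'd \<Rightarrow> real ^ 'd::finite"
  assumes "linear \<sigma>" "\<sigma> \<tau> = s"
  shows "g_TN \<sigma> x (torus_inf s x) (torus_inf s x) \<le> (norm \<tau>)\<^sup>2"
  using g_TN_le_lift_energy[OF assms(1), of x "torus_inf s x" "- \<tau>"] assms
  by (simp add: lift_energy_def mu_sigma_derivative_torus_inf linear_neg torus_inf_uminus)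

section \<open>The moment map and the phase of a coordinate\<close>

definition coord_norm :: "'d::finite quat \<Rightarrow> 'd \<Rightarrow> real" where
  "coord_norm x k = norm (fst x $ k, snd x $ k)"

lemma coord_norm_nonneg [simp]: "0 \<le> coord_norm x k"
  by (simp add: coord_norm_def)

lemma coord_norm_power2: "(coord_norm x k)\<^sup>2 = (cmod (fst x $ k))\<^sup>2 + (cmod (snd x $ k))\<^sup>2"
  by (simp add: coord_norm_def norm_prod_def)

lemma coord_norm_ge: "cmod (fst x $ k) \<le> coord_norm x k" "cmod (snd x $ k) \<le> coord_norm x k"
  unfolding coord_norm_def by (rule norm_fst_le, rule norm_snd_le)

lemma coord_norm_scaleR: "coord_norm (r *\<^sub>R x) k = \<bar>r\<bar> * coord_norm x k"
  using norm_scaleR[of r "(fst x $ k, snd x $ k)"] by (simp add: coord_norm_def)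

lemma coord_norm_triangle: "coord_norm (x + y) k \<le> coord_norm x k + coord_norm y k"
  using norm_triangle_ineq[of "(fst x $ k, snd x $ k)" "(fst y $ k, snd y $ k)"]
  by (simp add: coord_norm_def)

lemma norm_power2_eq_sum_coord_norm: "(norm x)\<^sup>2 = (\<Sum>k\<in>UNIV. (coord_norm x k)\<^sup>2)"
  by (cases x) (simp add: coord_norm_power2 norm_prod_def norm_vec_def L2_set_def sum.distrib
      sum_nonneg)

lemma coord_norm_le_norm: "coord_norm x k \<le> norm x"
  by (rule power2_le_imp_le)
    (auto simp: norm_power2_eq_sum_coord_norm intro!: member_le_sum)

lemma norm_le_sum_coord_norm: "norm x \<le> (\<Sum>k\<in>UNIV. coord_norm x k)"
proof -
  have "norm x = L2_set (coord_norm x) UNIV"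
    unfolding L2_set_def norm_power2_eq_sum_coord_norm[symmetric] by simp
  also have "\<dots> \<le> (\<Sum>k\<in>UNIV. coord_norm x k)"
    by (rule L2_set_le_sum) simp
  finally show ?thesis .
qed

section \<open>Estimates for the moment map and its derivative\<close>

lemma has_derivative_torus_moment:
  fixes x :: "'d::finite quat"
  shows "(torus_moment has_derivative (\<lambda>u.
    (\<chi> k. inner (snd x $ k) (snd u $ k) - inner (fst x $ k) (fst u $ k),
     \<chi> k. Re (\<i> * (fst x $ k * snd u $ k + fst u $ k * snd x $ k)),
     \<chi> k. Im (\<i> * (fst x $ k * snd u $ k + fst u $ k * snd x $ k))))) (at x)"
proof -
  have f: "((\<lambda>x :: 'd quat. fst x $ k) has_derivative (\<lambda>u. fst u $ k)) (at x)" for k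
    using bounded_linear.has_derivative[OF bounded_linear_vec_nth
        has_derivative_fst[OF has_derivative_ident]] .
  have s: "((\<lambda>x :: 'd quat. snd x $ k) has_derivative (\<lambda>u. snd u $ k)) (at x)" for k
    using bounded_linear.has_derivative[OF bounded_linear_vec_nth
        has_derivative_snd[OF has_derivative_ident]] .
  have p: "((\<lambda>x :: 'd quat. \<i> * (fst x $ k * snd x $ k)) has_derivative
      (\<lambda>u. \<i> * (fst x $ k * snd u $ k + fst u $ k * snd x $ k))) (at x)" for k
    by (rule has_derivative_eq_rhs, rule has_derivative_mult_right, rule has_derivative_mult[OF f s])
      (simp add: fun_eq_iff algebra_simps)
  show ?thesis
    unfolding torus_moment_def[abs_def] power2_norm_eq_inner
    by (intro has_derivative_Pair; rule has_derivative_vec; simp only: vec_lambda_beta)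
      (auto intro!: derivative_eq_intros f s bounded_linear.has_derivative[OF bounded_linear_Re p]
        bounded_linear.has_derivative[OF bounded_linear_Im p] simp: fun_eq_iff inner_commute)
qed

text \<open>The moment map is quadratic and does not mix coordinates. The product form matters: a
  displacement inversely proportional to the size of a far coordinate costs only a bounded change of
  moment. The factor 6 is 2 for each of three components.\<close>

lemma norm_torus_moment_derivative_le:
  fixes x u :: "'d::finite quat"
  shows "norm (frechet_derivative torus_moment (at x) u) \<le>
    6 * (\<Sum>k\<in>UNIV. coord_norm x k * coord_norm u k)"
proof -
  let ?S = "2 * (\<Sum>k\<in>UNIV. coord_norm x k * coord_norm u k)"
  have bound: "norm v \<le> ?S"
    if "\<And>k. \<bar>v $ k\<bar> \<le> 2 * (coord_norm x k * coord_norm u k)" for v :: "real ^ 'd"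
    using order_trans[OF norm_le_l1_cart[of v] sum_mono[of UNIV, OF that]]
    by (simp add: sum_distrib_left)
  have prods: "cmod (fst x $ k) * cmod (snd u $ k) \<le> coord_norm x k * coord_norm u k"
    "cmod (fst u $ k) * cmod (snd x $ k) \<le> coord_norm x k * coord_norm u k"
    "cmod (snd x $ k) * cmod (snd u $ k) \<le> coord_norm x k * coord_norm u k"
    "cmod (fst x $ k) * cmod (fst u $ k) \<le> coord_norm x k * coord_norm u k" for k
    by (simp_all add: mult_mono coord_norm_ge)
      (simp add: mult.commute[of "coord_norm x k"] mult_mono coord_norm_ge)
  have "norm (\<chi> k. inner (snd x $ k) (snd u $ k) - inner (fst x $ k) (fst u $ k)) \<le> ?S"
  proof (rule bound)
    fix k
    show "\<bar>(\<chi> k. inner (snd x $ k) (snd u $ k) - inner (fst x $ k) (fst u $ k)) $ k\<bar> \<le>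
        2 * (coord_norm x k * coord_norm u k)"
      using Cauchy_Schwarz_ineq2[of "snd x $ k" "snd u $ k"] prods(3)[of k]
        Cauchy_Schwarz_ineq2[of "fst x $ k" "fst u $ k"] prods(4)[of k]
      by simp
  qed
  moreover
  have c: "cmod (\<i> * (fst x $ k * snd u $ k + fst u $ k * snd x $ k)) \<le>
      2 * (coord_norm x k * coord_norm u k)" for k
    using norm_triangle_ineq[of "fst x $ k * snd u $ k" "fst u $ k * snd x $ k"]
      prods(1)[of k] prods(2)[of k]
    by (simp add: norm_mult)
  have "norm (\<chi> k. Re (\<i> * (fst x $ k * snd u $ k + fst u $ k * snd x $ k))) \<le> ?S"
    by (rule bound) (simp only: vec_lambda_beta order_trans[OF abs_Re_le_cmod c])
  moreover
  have "norm (\<chi> k. Im (\<i> * (fst x $ k * snd u $ k + fst u $ k * snd x $ k))) \<le> ?S"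
    by (rule bound) (simp only: vec_lambda_beta order_trans[OF abs_Im_le_cmod c])
  moreover have "norm (a, b, c) \<le> norm a + norm b + norm c" for a b c :: "real ^ 'd"
    using norm_Pair_le[of a "(b, c)"] norm_Pair_le[of b c] by linarith
  ultimately show ?thesis
    unfolding frechet_derivative_at[OF has_derivative_torus_moment, symmetric]
    by - (rule order_trans, assumption, linarith)
qed

text \<open>The adjoint of \<open>\<sigma>\<close> is inverted by the adjoint of
  \<open>inv \<sigma>\<close>. This turns Lipschitz bounds for \<open>mu_sigma\<close> into bounds
  for \<open>torus_moment\<close>, whose components separate the coordinates.\<close>

lemma torus_moment_bounded_by_mu_sigma:
  fixes \<sigma> :: "real ^ 'd \<Rightarrow> real ^ 'd::finite"
  assumes "linear \<sigma>" "bij \<sigma>"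
  obtains C where "C > 0"
    "\<And>x y. norm (torus_moment x - torus_moment y) \<le> C * norm (mu_sigma \<sigma> x - mu_sigma \<sigma> y)"
proof -
  let ?T = "\<lambda>\<sigma> :: real ^ 'd \<Rightarrow> real ^ 'd. map_prod (adjoint \<sigma>) (map_prod (adjoint \<sigma>) (adjoint \<sigma>))"
  have lin: "linear (inv \<sigma>)"
    using assms by (metis bij_is_inj inj_linear_imp_inv_linear)
  have "adjoint (inv \<sigma>) (adjoint \<sigma> v) = v" for v
  proof -
    have "inner (adjoint (inv \<sigma>) (adjoint \<sigma> v)) w = inner v w" for w
      using assms by (simp add: adjoint_clauses lin bij_is_surj surj_f_inv_f)
    then show ?thesis
      by (metis vector_eq_rdot)
  qed
  then have T: "?T (inv \<sigma>) (?T \<sigma> a) = a" for a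
    by (simp add: map_prod_def split: prod.split)
  obtain C where C: "C > 0" "\<And>a. norm (?T (inv \<sigma>) a) \<le> C * norm a"
    using linear_bounded_pos[OF linear_adjoint3[OF lin]] by blast
  have "norm (torus_moment x - torus_moment y) \<le> C * norm (mu_sigma \<sigma> x - mu_sigma \<sigma> y)" for x y
    using C(2)[of "mu_sigma \<sigma> x - mu_sigma \<sigma> y"]
    unfolding linear_diff[OF linear_adjoint3[OF lin]] by (simp only: mu_sigma_def T)
  with C(1) show thesis
    by (rule that)
qed

lemma mu_sigma_derivative_bound:
  fixes \<sigma> :: "real ^ 'd \<Rightarrow> real ^ 'd::finite"
  assumes "linear \<sigma>"
  obtains C where "C > 0" "\<And>x u. norm (frechet_derivative (mu_sigma \<sigma>) (at x) u) \<le>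
    C * (\<Sum>k\<in>UNIV. coord_norm x k * coord_norm u k)"
proof -
  let ?T = "map_prod (adjoint \<sigma>) (map_prod (adjoint \<sigma>) (adjoint \<sigma>))"
  obtain C where C: "C > 0" "\<And>a. norm (?T a) \<le> C * norm a"
    using linear_bounded_pos[OF linear_adjoint3[OF assms]] by blast
  have "frechet_derivative (mu_sigma \<sigma>) (at x) u = ?T (frechet_derivative torus_moment (at x) u)" for x u
  proof -
    have "(?T \<circ> torus_moment has_derivative ?T \<circ> frechet_derivative torus_moment (at x)) (at x)"
      using differentiable_torus_moment linear_imp_has_derivative[OF linear_adjoint3[OF assms]]
      by (intro diff_chain_at) (simp_all flip: frechet_derivative_works)
    moreover have "?T \<circ> torus_moment = mu_sigma \<sigma>"
      by (simp add: mu_sigma_def fun_eq_iff)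
    ultimately show ?thesis
      by (simp add: frechet_derivative_at[symmetric])
  qed
  then have "norm (frechet_derivative (mu_sigma \<sigma>) (at x) u) \<le>
      C * (6 * (\<Sum>k\<in>UNIV. coord_norm x k * coord_norm u k))" for x u
    by (simp only:) (rule order_trans[OF C(2)
        mult_left_mono[OF norm_torus_moment_derivative_le less_imp_le[OF C(1)]]])
  then have "norm (frechet_derivative (mu_sigma \<sigma>) (at x) u) \<le>
      (6 * C) * (\<Sum>k\<in>UNIV. coord_norm x k * coord_norm u k)" for x u
    by (simp add: mult.left_commute mult.assoc)
  with C(1) show thesis
    by (intro that[of "6 * C"]) auto
qed

text \<open>The Hermitian product of the spinors \<open>(z, cnj w)\<close> of \<open>x\<close> and \<open>q\<close>, on which the torus acts
  by scalars.  Its phase is the fibre coordinate of the moment map near \<open>q\<close>.\<close>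

definition spin_prod :: "'d::finite quat \<Rightarrow> 'd quat \<Rightarrow> 'd \<Rightarrow> complex" where
  "spin_prod q x k = fst x $ k * cnj (fst q $ k) + cnj (snd x $ k) * snd q $ k"

lemma spin_prod_torus_act: "spin_prod q (torus_act t x) k = cis (- (t $ k)) * spin_prod q x k"
  by (simp add: spin_prod_def torus_act_def cis_cnj algebra_simps)

lemma spin_prod_torus_inf: "spin_prod q (torus_inf t x) k = - (\<i> * t $ k * spin_prod q x k)"
  by (simp add: spin_prod_def torus_inf_def algebra_simps)

lemma spin_prod_add: "spin_prod q (x + y) k = spin_prod q x k + spin_prod q y k"
  by (simp add: spin_prod_def algebra_simps)

lemma spin_prod_self: "spin_prod q q k = of_real ((coord_norm q k)\<^sup>2)"
  by (simp add: spin_prod_def coord_norm_power2 complex_norm_square[unfolded of_real_power] mult.commute)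

lemma bounded_linear_spin_prod: "bounded_linear (\<lambda>x. spin_prod q x k)"
  by (rule linear_conv_bounded_linear[THEN iffD1], rule linearI)
    (simp_all add: spin_prod_def complex_eq_iff algebra_simps)

lemma norm_spin_prod_le: "cmod (spin_prod q x k) \<le> 2 * (coord_norm q k * coord_norm x k)"
proof -
  have "cmod (spin_prod q x k) \<le> cmod (fst q $ k) * cmod (fst x $ k) + cmod (snd q $ k) * cmod (snd x $ k)"
    unfolding spin_prod_def by (rule order_trans[OF norm_triangle_ineq]) (simp add: norm_mult)
  also have "\<dots> \<le> coord_norm q k * coord_norm x k + coord_norm q k * coord_norm x k"
    by (intro add_mono mult_mono coord_norm_ge) simp_all
  finally show ?thesis by simp
qed

text \<open>The Hopf map identity for the spinors \<open>(z, cnj w)\<close> and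
  \<open>(a, cnj b)\<close>: the Hopf image of a spinor has half its squared length, and the squared
  Hermitian product is determined by lengths and the scalar product of the images.\<close>

lemma spin_identity:
  fixes z w a b :: complex
  shows "(cmod (z * cnj a + cnj w * b))\<^sup>2 +
    (((cmod w)\<^sup>2 - (cmod z)\<^sup>2) / 2 - ((cmod b)\<^sup>2 - (cmod a)\<^sup>2) / 2)\<^sup>2 + (cmod (z * w - a * b))\<^sup>2 =
    (((cmod z)\<^sup>2 + (cmod w)\<^sup>2 + (cmod a)\<^sup>2 + (cmod b)\<^sup>2) / 2)\<^sup>2"
  unfolding cmod_power2 by (simp add: field_simps power2_eq_square)

lemma norm_spin_prod_ge:
  fixes x q :: "'d::finite quat"
  shows "(((coord_norm x k)\<^sup>2 + (coord_norm q k)\<^sup>2) / 2)\<^sup>2 - (norm (torus_moment x - torus_moment q))\<^sup>2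
    \<le> (cmod (spin_prod q x k))\<^sup>2"
proof -
  define m where "m = torus_moment x - torus_moment q"
  have nth: "(v $ k)\<^sup>2 \<le> (norm v)\<^sup>2" for v :: "real ^ 'd"
    using component_le_norm_cart[of v k] by (metis abs_le_square_iff abs_norm_cancel)
  have "(fst m $ k)\<^sup>2 + (fst (snd m) $ k)\<^sup>2 + (snd (snd m) $ k)\<^sup>2 \<le> (norm m)\<^sup>2"
    using nth[of "fst m"] nth[of "fst (snd m)"] nth[of "snd (snd m)"]
    by (simp add: norm_prod_def)
  moreover have "(fst (snd m) $ k)\<^sup>2 + (snd (snd m) $ k)\<^sup>2 =
      (cmod (fst x $ k * snd x $ k - fst q $ k * snd q $ k))\<^sup>2"
    unfolding cmod_power2 by (simp add: m_def torus_moment_def power2_eq_square algebra_simps)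
  moreover have "fst m $ k = ((cmod (snd x $ k))\<^sup>2 - (cmod (fst x $ k))\<^sup>2) / 2 -
      ((cmod (snd q $ k))\<^sup>2 - (cmod (fst q $ k))\<^sup>2) / 2"
    by (simp add: m_def torus_moment_def)
  ultimately show ?thesis
    using spin_identity[of "fst x $ k" "fst q $ k" "snd x $ k" "snd q $ k"]
    by (simp add: m_def[symmetric] spin_prod_def coord_norm_power2 add.assoc)
qed

text \<open>Keeps the phase relative to \<open>q\<close> defined, and its rate of turning under
  control, as long as the moment stays near that of \<open>q\<close>. By the spin identity the
  squared product is at least \<open>(Q/2)^2 - (Q/4)^2\<close>, where \<open>Q\<close> is the
  squared size of the coordinate of \<open>q\<close>.\<close>

lemma norm_spin_prod_ge_quarter:
  assumes "norm (torus_moment x - torus_moment q) \<le> \<delta>" "4 * \<delta> \<le> (coord_norm q k)\<^sup>2"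
  shows "(coord_norm q k)\<^sup>2 / 4 \<le> cmod (spin_prod q x k)"
proof (rule power2_le_imp_le)
  let ?Q = "(coord_norm q k)\<^sup>2"
  have "(norm (torus_moment x - torus_moment q))\<^sup>2 \<le> (?Q / 4)\<^sup>2"
    using assms by (intro power_mono) auto
  moreover have "(?Q / 2)\<^sup>2 \<le> (((coord_norm x k)\<^sup>2 + ?Q) / 2)\<^sup>2"
    by (intro power_mono) auto
  moreover have "(?Q / 4)\<^sup>2 \<le> (?Q / 2)\<^sup>2 - (?Q / 4)\<^sup>2"
    by (simp add: power_divide)
  ultimately show "(?Q / 4)\<^sup>2 \<le> (cmod (spin_prod q x k))\<^sup>2"
    using norm_spin_prod_ge[of x k q] by linarith
qed simp

text \<open>Once phases are aligned, the squared distance is \<open>2 * (A - h)\<close>, while the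
  spin identity bounds \<open>(A - h) * (A + h)\<close> by the square of \<delta>, and
  \<open>A + h\<close> is at least half the squared size of \<open>q\<close>. Thus a point with
  moment near that of \<open>q\<close> lies, after a rotation, in a thin tube around
  \<open>q\<close>.\<close>

lemma coord_norm_diff_le_of_aligned:
  assumes "norm (torus_moment x - torus_moment q) \<le> \<delta>"
    and aligned: "spin_prod q x k = of_real (cmod (spin_prod q x k))"
  shows "coord_norm (x - q) k * coord_norm q k \<le> 2 * \<delta>"
proof -
  let ?Q = "(coord_norm q k)\<^sup>2"
  define A where "A = ((coord_norm x k)\<^sup>2 + ?Q) / 2"
  define h where "h = cmod (spin_prod q x k)"
  have "0 \<le> \<delta>"
    using assms(1) norm_ge_zero order_trans by blast
  have "(norm (torus_moment x - torus_moment q))\<^sup>2 \<le> \<delta>\<^sup>2"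
    using assms(1) by (intro power_mono) auto
  then have "A\<^sup>2 - h\<^sup>2 \<le> \<delta>\<^sup>2"
    using norm_spin_prod_ge[of x k q] unfolding A_def h_def by linarith
  have "Re (spin_prod q x k) = h"
    using aligned unfolding h_def by (metis Re_complex_of_real)
  moreover have "(coord_norm (x - q) k)\<^sup>2 = 2 * A - 2 * Re (spin_prod q x k)"
    unfolding A_def coord_norm_power2 spin_prod_def cmod_power2
    by (simp add: field_simps power2_eq_square)
  ultimately have u: "(coord_norm (x - q) k)\<^sup>2 = 2 * (A - h)"
    by simp
  have "0 \<le> 2 * (A - h)"
    unfolding u[symmetric] by simp
  then have "h \<le> A" by simp
  have "?Q \<le> 2 * A"
    unfolding A_def by simp
  have "0 \<le> h" by (simp add: h_def)
  have "(A - h) * ?Q \<le> (A - h) * (2 * (A + h))"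
    using \<open>h \<le> A\<close> \<open>0 \<le> h\<close> \<open>?Q \<le> 2 * A\<close> by (intro mult_left_mono) auto
  also have "\<dots> = 2 * (A\<^sup>2 - h\<^sup>2)"
    by (simp add: power2_eq_square algebra_simps)
  also have "\<dots> \<le> 2 * \<delta>\<^sup>2"
    using \<open>A\<^sup>2 - h\<^sup>2 \<le> \<delta>\<^sup>2\<close> by simp
  finally have "(A - h) * ?Q \<le> 2 * \<delta>\<^sup>2" .
  moreover have "2 * (A - h) * ?Q = 2 * ((A - h) * ?Q)" "2\<^sup>2 * \<delta>\<^sup>2 = 2 * (2 * \<delta>\<^sup>2)"
    by simp_all
  ultimately have "2 * (A - h) * ?Q \<le> 2\<^sup>2 * \<delta>\<^sup>2"
    by linarith
  then have "(coord_norm (x - q) k * coord_norm q k)\<^sup>2 \<le> (2 * \<delta>)\<^sup>2"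
    unfolding power_mult_distrib u .
  then show ?thesis
    by (rule power2_le_imp_le) (simp add: \<open>0 \<le> \<delta>\<close>)
qed

section \<open>Curves of bounded speed\<close>

lemma norm_diff_le_of_speed:
  fixes f :: "real \<Rightarrow> 'b::real_normed_vector"
  assumes "\<And>t. t \<in> {0..1} \<Longrightarrow> (f has_vector_derivative f' t) (at t within {0..1})"
    and "\<And>t. t \<in> {0..1} \<Longrightarrow> norm (f' t) \<le> B"
    and "s \<in> {0..1}" "t \<in> {0..1}"
  shows "norm (f t - f s) \<le> B"
proof -
  have "norm (f t - f s) \<le> B * norm (t - s)"
    using assms(1)[unfolded has_vector_derivative_def] assms
    by (intro differentiable_bound[of "{0..1}" f "\<lambda>t h. h *\<^sub>R f' t"])
      (auto simp: onorm_scaleR_left bounded_linear_ident onorm_id)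
  also have "0 \<le> B"
    using assms(2)[OF assms(3)] norm_ge_zero order_trans by blast
  then have "B * norm (t - s) \<le> B"
    using assms(3,4) by (intro mult_left_le) auto
  finally show ?thesis .
qed

text \<open>Logarithms obtained from contractibility are only known to be continuous. Near
  \<open>t\<close> continuity keeps the imaginary part of \<open>L s - L t\<close> in the range of
  the principal branch, so \<open>L\<close> is locally \<open>Ln\<close> of a quotient plus a
  constant.\<close>

lemma has_vector_derivative_continuous_log:
  fixes z L :: "real \<Rightarrow> complex"
  assumes exp: "\<And>s. s \<in> S \<Longrightarrow> z s = exp (L s)" and L: "continuous_on S L" and t: "t \<in> S"
    and z: "(z has_vector_derivative z') (at t within S)"
  shows "(L has_vector_derivative z' / z t) (at t within S)"
proof -
  have "z t \<noteq> 0"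
    by (simp add: exp t)
  obtain d where d: "d > 0" "\<And>s. s \<in> S \<Longrightarrow> dist s t < d \<Longrightarrow> dist (L s) (L t) < pi"
    using L t unfolding continuous_on_iff using pi_gt_zero by blast
  have eq: "L t + Ln (z s / z t) = L s" if "s \<in> S" "dist s t < d" for s
  proof -
    have "\<bar>Im (L s - L t)\<bar> < pi"
      using d(2)[OF that] abs_Im_le_cmod[of "L s - L t"] by (simp add: dist_norm)
    then have "Ln (exp (L s - L t)) = L s - L t"
      by (intro Ln_exp) auto
    then show ?thesis
      by (simp add: exp that t exp_diff)
  qed
  have "((\<lambda>s. L t + Ln (z s / z t)) has_vector_derivative z' / z t) (at t within S)"
  proof -
    have "((\<lambda>s. z s / z t) has_vector_derivative z' / z t) (at t within S)"
      using has_vector_derivative_divide[OF z] by simp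
    moreover have "(Ln has_field_derivative 1) (at (z t / z t) within (\<lambda>s. z s / z t) ` S)"
      using \<open>z t \<noteq> 0\<close> has_field_derivative_Ln[of 1] by (simp add: has_field_derivative_at_within)
    ultimately have "((Ln \<circ> (\<lambda>s. z s / z t)) has_vector_derivative z' / z t * 1) (at t within S)"
      by (rule field_vector_diff_chain_within)
    from has_vector_derivative_add[OF has_vector_derivative_const this] show ?thesis
      by (simp add: o_def)
  qed
  from has_vector_derivative_transform_within[OF this d(1) t eq] show ?thesis .
qed

text \<open>A pointwise speed bound on the unit interval stands in for length; the chain rule
  transports it under isometries.\<close>

definition has_speed_le ::
  "(real ^ 'd \<Rightarrow> real ^ 'd) \<Rightarrow> (real \<Rightarrow> 'd::finite quat) \<Rightarrow> real \<Rightarrow> bool" where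
  "has_speed_le \<sigma> c l \<longleftrightarrow> (\<exists>c'. \<forall>t\<in>{0..1}. (c has_vector_derivative c' t) (at t within {0..1}) \<and>
     g_TN \<sigma> (c t) (c' t) (c' t) \<le> l\<^sup>2)"

lemma has_speed_le_imp_continuous_on:
  "has_speed_le \<sigma> c l \<Longrightarrow> continuous_on {0..1} c"
  unfolding has_speed_le_def
  by (metis continuous_on_eq_continuous_within has_vector_derivative_continuous)

lemma mu_sigma_diff_le_speed:
  fixes \<sigma> :: "real ^ 'd \<Rightarrow> real ^ 'd::finite"
  assumes lin: "linear \<sigma>" and c: "has_speed_le \<sigma> c l" and "0 \<le> l" and st: "s \<in> {0..1}" "t \<in> {0..1}"
  shows "norm (mu_sigma \<sigma> (c t) - mu_sigma \<sigma> (c s)) \<le> l"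
proof -
  obtain c' where c': "\<And>t. t \<in> {0..1} \<Longrightarrow> (c has_vector_derivative c' t) (at t within {0..1})"
    "\<And>t. t \<in> {0..1} \<Longrightarrow> g_TN \<sigma> (c t) (c' t) (c' t) \<le> l\<^sup>2"
    using c unfolding has_speed_le_def by blast
  have "((mu_sigma \<sigma> \<circ> c) has_vector_derivative frechet_derivative (mu_sigma \<sigma>) (at (c t)) (c' t))
      (at t within {0..1})" if "t \<in> {0..1}" for t
    by (rule vector_derivative_diff_chain_within[OF c'(1)[OF that]
          has_derivative_at_withinI[OF mu_sigma_has_derivative[OF lin]]])
  from norm_diff_le_of_speed[OF this norm_mu_sigma_derivative_le[OF lin c'(2) \<open>0 \<le> l\<close>] st]
  show ?thesis by simp
qed

lemma has_speed_le_torus_orbit: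
  fixes \<sigma> :: "real ^ 'd \<Rightarrow> real ^ 'd::finite"
  assumes lin: "linear \<sigma>"
  shows "has_speed_le \<sigma> (\<lambda>t. torus_act (t *\<^sub>R \<sigma> \<tau>) x) (norm \<tau>)"
proof -
  let ?c = "\<lambda>t. torus_act (t *\<^sub>R \<sigma> \<tau>) x"
  have "(?c has_vector_derivative torus_inf (\<sigma> \<tau>) (?c t)) (at t within {0..1})" for t
  proof -
    have "((\<lambda>t. t *\<^sub>R \<sigma> \<tau>) has_derivative (\<lambda>h. h *\<^sub>R \<sigma> \<tau>)) (at t)"
      by (auto intro!: derivative_eq_intros)
    from has_derivative_torus_act[OF this has_derivative_const, of x]
    have "(?c has_derivative (\<lambda>h. torus_act (t *\<^sub>R \<sigma> \<tau>) (torus_inf (h *\<^sub>R \<sigma> \<tau>) x))) (at t)"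
      by simp
    moreover have "torus_act (t *\<^sub>R \<sigma> \<tau>) (torus_inf (h *\<^sub>R \<sigma> \<tau>) x) = h *\<^sub>R torus_inf (\<sigma> \<tau>) (?c t)" for h
      unfolding torus_act_torus_inf
      by (simp add: torus_inf_def prod_eq_iff vec_eq_iff complex_eq_iff algebra_simps)
    ultimately show ?thesis
      unfolding has_vector_derivative_def by (simp add: has_derivative_at_withinI)
  qed
  then show ?thesis
    unfolding has_speed_le_def
    by (intro exI[of _ "\<lambda>t. torus_inf (\<sigma> \<tau>) (?c t)"] ballI conjI g_TN_torus_inf_le[OF lin refl])
qed

text \<open>The competitor \<open>\<tau> = 0\<close> bounds the metric by the Euclidean norm and the
  derivative of the moment map. The constant is uniform in \<open>x\<close> because only the
  products of position and displacement enter.\<close>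

lemma straight_line_speed:
  fixes \<sigma> :: "real ^ 'd \<Rightarrow> real ^ 'd::finite"
  assumes lin: "linear \<sigma>"
  obtains C where "C > 0"
    "\<And>x u B b. (\<And>k t. t \<in> {0..1} \<Longrightarrow> coord_norm (x + t *\<^sub>R u) k * coord_norm u k \<le> B) \<Longrightarrow>
       (\<And>k. coord_norm u k \<le> b) \<Longrightarrow> has_speed_le \<sigma> (\<lambda>t. x + t *\<^sub>R u) (C * B + C * b)"
proof -
  obtain C where C: "C > 0" "\<And>x u. norm (frechet_derivative (mu_sigma \<sigma>) (at x) u) \<le>
      C * (\<Sum>k\<in>UNIV. coord_norm x k * coord_norm u k)"
    using mu_sigma_derivative_bound[OF lin] by blast
  let ?d = "of_nat CARD('d) :: real"
  let ?C = "(C + 1) * ?d"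
  have "has_speed_le \<sigma> (\<lambda>t. x + t *\<^sub>R u) (?C * B + ?C * b)"
    if B: "\<And>k t. t \<in> {0..1} \<Longrightarrow> coord_norm (x + t *\<^sub>R u) k * coord_norm u k \<le> B"
      and b: "\<And>k. coord_norm u k \<le> b" for x u :: "'d quat" and B b
    unfolding has_speed_le_def
  proof (intro exI[of _ "\<lambda>t. u"] ballI conjI)
    fix t :: real
    assume t: "t \<in> {0..1}"
    show "((\<lambda>t. x + t *\<^sub>R u) has_vector_derivative u) (at t within {0..1})"
      unfolding has_vector_derivative_def by (auto intro!: derivative_eq_intros)
    have pos: "0 \<le> B" "0 \<le> b"
      using order_trans[OF _ B[OF t]] order_trans[OF _ b] by simp_all
    let ?x = "x + t *\<^sub>R u"
    have "norm (frechet_derivative (mu_sigma \<sigma>) (at ?x) u) \<le> C * (?d * B)"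
      using order_trans[OF C(2) mult_left_mono[OF sum_bounded_above[OF B[OF t]]]] C(1) by force
    also have "\<dots> \<le> ?C * B"
      using pos by (simp add: algebra_simps)
    finally have 1: "norm (frechet_derivative (mu_sigma \<sigma>) (at ?x) u) \<le> ?C * B" .
    have "norm u \<le> ?d * b"
      using order_trans[OF norm_le_sum_coord_norm sum_bounded_above[OF b]] by simp
    also have "\<dots> \<le> ?C * b"
      using pos C(1) by (simp add: algebra_simps)
    finally have 2: "norm u \<le> ?C * b" .
    have "g_TN \<sigma> ?x u u \<le> lift_energy \<sigma> ?x u 0"
      by (rule g_TN_le_lift_energy[OF lin])
    also have "\<dots> = (norm (frechet_derivative (mu_sigma \<sigma>) (at ?x) u))\<^sup>2 + (norm u)\<^sup>2"
      by (simp add: lift_energy_def linear_0[OF lin] torus_inf_0)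
    also have "\<dots> \<le> (?C * B)\<^sup>2 + (?C * b)\<^sup>2"
      using 1 2 by (intro add_mono power_mono) auto
    also have "\<dots> \<le> (?C * B + ?C * b)\<^sup>2"
      using pos C(1) by (simp add: power2_sum)
    finally show "g_TN \<sigma> ?x u u \<le> (?C * B + ?C * b)\<^sup>2" .
  qed
  moreover have "?C > 0"
    using C(1) by simp
  ultimately show thesis
    using that by blast
qed

text \<open>Take the lift \<open>V\<close> of the velocity with minimal energy and real part
  \<open>\<tau>\<close>. Differentiating the logarithm of the spin product gives phase velocity
  \<open>\<sigma> \<tau>\<close> plus the contribution of \<open>V\<close> divided by the size of
  \<open>q\<close>. Both \<open>\<tau>\<close> and \<open>V\<close> have norm at most
  \<open>l\<close>, so far out the phase moves at most slightly faster, in lattice length, than the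
  curve.\<close>

lemma phase_shift_le_speed:
  fixes \<sigma> :: "real ^ 'd \<Rightarrow> real ^ 'd::finite"
  assumes lin: "linear \<sigma>" and bij: "bij \<sigma>"
  obtains C where "C > 0"
    "\<And>q Y l c L. Y > 0 \<Longrightarrow> (\<And>k. Y \<le> (coord_norm q k)\<^sup>2) \<Longrightarrow> 0 \<le> l \<Longrightarrow> has_speed_le \<sigma> c l \<Longrightarrow>
      (\<And>t k. t \<in> {0..1} \<Longrightarrow> (coord_norm q k)\<^sup>2 / 4 \<le> cmod (spin_prod q (c t) k)) \<Longrightarrow>
      (\<And>k. continuous_on {0..1} (\<lambda>t. L t k)) \<Longrightarrow>
      (\<And>t k. t \<in> {0..1} \<Longrightarrow> spin_prod q (c t) k = exp (L t k)) \<Longrightarrow>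
      norm (inv \<sigma> (\<chi> k. Im (L 1 k) - Im (L 0 k))) \<le> (1 + C / sqrt Y) * l"
proof -
  have lini: "linear (inv \<sigma>)"
    using lin bij by (metis bij_is_inj inj_linear_imp_inv_linear)
  obtain K where K: "K > 0" "\<And>v. norm (inv \<sigma> v) \<le> K * norm v"
    using linear_bounded_pos[OF lini] by blast
  let ?d = "of_nat CARD('d) :: real"
  \<comment> \<open>The 8 is the factor 2 of \<open>norm_spin_prod_le\<close> over the lower bound
    by a quarter; \<open>?d\<close> passes from components to the norm.\<close>
  define C where "C = K * (?d * 8)"
  have "norm (inv \<sigma> (\<chi> k. Im (L 1 k) - Im (L 0 k))) \<le> (1 + C / sqrt Y) * l"
    if Y: "Y > 0" "\<And>k. Y \<le> (coord_norm q k)\<^sup>2" and "0 \<le> l" and c: "has_speed_le \<sigma> c l"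
      and spin: "\<And>t k. t \<in> {0..1} \<Longrightarrow> (coord_norm q k)\<^sup>2 / 4 \<le> cmod (spin_prod q (c t) k)"
      and contL: "\<And>k. continuous_on {0..1} (\<lambda>t. L t k)"
      and L: "\<And>t k. t \<in> {0..1} \<Longrightarrow> spin_prod q (c t) k = exp (L t k)"
    for q :: "'d quat" and Y l c and L :: "real \<Rightarrow> 'd \<Rightarrow> complex"
  proof -
    obtain c' where c': "\<And>t. t \<in> {0..1} \<Longrightarrow> (c has_vector_derivative c' t) (at t within {0..1})"
      "\<And>t. t \<in> {0..1} \<Longrightarrow> g_TN \<sigma> (c t) (c' t) (c' t) \<le> l\<^sup>2"
      using c unfolding has_speed_le_def by blast
    define w where "w t = (\<chi> k. Im (spin_prod q (c' t) k / spin_prod q (c t) k))" for t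
    have "((\<lambda>t. \<chi> k. Im (L t k)) has_vector_derivative w t) (at t within {0..1})" if t: "t \<in> {0..1}" for t
    proof -
      have "((\<lambda>t. Im (L t k)) has_vector_derivative w t $ k) (at t within {0..1})" for k
        using bounded_linear.has_vector_derivative[OF bounded_linear_Im
            has_vector_derivative_continuous_log[OF L contL t
              bounded_linear.has_vector_derivative[OF bounded_linear_spin_prod c'(1)[OF t]]]]
        by (simp add: w_def)
      then show ?thesis
        unfolding has_vector_derivative_def by (intro has_derivative_vec) simp
    qed
    then have deriv: "((\<lambda>t. inv \<sigma> (\<chi> k. Im (L t k))) has_vector_derivative inv \<sigma> (w t))
        (at t within {0..1})" if "t \<in> {0..1}" for t
      using that bounded_linear.has_vector_derivative[OF linear_conv_bounded_linear[THEN iffD1, OF lini]] by blast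
    have bound: "norm (inv \<sigma> (w t)) \<le> (1 + C / sqrt Y) * l" if t: "t \<in> {0..1}" for t
    proof -
      obtain \<tau> where \<tau>: "g_TN \<sigma> (c t) (c' t) (c' t) = lift_energy \<sigma> (c t) (c' t) \<tau>"
        using g_TN_eq_lift_energy[OF lin] by blast
      define V where "V = c' t + torus_inf (\<sigma> \<tau>) (c t)"
      have energy: "(norm V)\<^sup>2 + (norm \<tau>)\<^sup>2 \<le> l\<^sup>2"
        using c'(2)[OF t] unfolding \<tau> lift_energy_def V_def
        by (smt (verit) zero_le_power2)
      then have V: "norm V \<le> l" and "norm \<tau> \<le> l"
        using \<open>0 \<le> l\<close> by (smt (verit) power2_le_imp_le zero_le_power2)+
      define e where "e = w t - \<sigma> \<tau>"
      have "\<bar>e $ k\<bar> \<le> 8 * l / sqrt Y" for k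
      proof -
        let ?q = "coord_norm q k" and ?s = "spin_prod q (c t) k"
        have q: "sqrt Y \<le> ?q" "0 < sqrt Y"
          using Y by (auto intro: real_le_lsqrt)
        have "?s \<noteq> 0"
          unfolding L[OF t] by simp
        have "spin_prod q V k = spin_prod q (c' t) k - \<i> * (\<sigma> \<tau>) $ k * ?s"
          by (simp add: V_def spin_prod_add spin_prod_torus_inf)
        then have "spin_prod q (c' t) k / ?s = spin_prod q V k / ?s + \<i> * (\<sigma> \<tau>) $ k"
          using \<open>?s \<noteq> 0\<close> by (simp add: field_simps)
        then have "e $ k = Im (spin_prod q V k / ?s)"
          by (simp add: e_def w_def)
        then have "\<bar>e $ k\<bar> \<le> cmod (spin_prod q V k) / cmod ?s"
          using abs_Im_le_cmod[of "spin_prod q V k / ?s"] by (simp add: norm_divide)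
        also have "\<dots> \<le> (2 * (?q * l)) / (?q\<^sup>2 / 4)"
        proof (rule frac_le)
          show "cmod (spin_prod q V k) \<le> 2 * (?q * l)"
            using norm_spin_prod_le[of q V k] coord_norm_le_norm[of V k] V
              mult_left_mono[of "coord_norm V k" l ?q] by simp
        qed (use q spin[OF t] \<open>0 \<le> l\<close> in auto)
        also have "\<dots> = 8 * l / ?q"
          by (simp add: power2_eq_square)
        also have "\<dots> \<le> 8 * l / sqrt Y"
          using q \<open>0 \<le> l\<close> by (intro divide_left_mono mult_pos_pos less_le_trans[OF q(2) q(1)]) auto
        finally show ?thesis .
      qed
      then have "norm e \<le> ?d * (8 * l / sqrt Y)"
        using order_trans[OF norm_le_l1_cart[of e] sum_bounded_above] by force
      then have "norm (inv \<sigma> e) \<le> K * (?d * (8 * l / sqrt Y))"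
        using K by (meson mult_left_mono order_trans less_imp_le)
      moreover have "inv \<sigma> (w t) = \<tau> + inv \<sigma> e"
        using bij by (simp add: e_def linear_diff[OF lini] bij_is_inj)
      ultimately show ?thesis
        using \<open>norm \<tau> \<le> l\<close> norm_triangle_ineq[of \<tau> "inv \<sigma> e"] by (simp add: C_def algebra_simps)
    qed
    have "norm (inv \<sigma> (\<chi> k. Im (L 1 k)) - inv \<sigma> (\<chi> k. Im (L 0 k))) \<le> (1 + C / sqrt Y) * l"
      by (rule norm_diff_le_of_speed[OF deriv bound]) auto
    moreover have "(\<chi> k. Im (L 1 k) - Im (L 0 k)) = (\<chi> k. Im (L 1 k)) - (\<chi> k. Im (L 0 k))"
      by (simp add: vec_eq_iff)
    ultimately show ?thesis
      by (simp add: linear_diff[OF lini])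
  qed
  moreover have "C > 0"
    using K(1) by (simp add: C_def)
  ultimately show thesis
    using that by blast
qed

section \<open>The lattice map of an isometry\<close>

lemma exp_eq_1_imp_constant:
  fixes g :: "'a::topological_space \<Rightarrow> complex"
  assumes "connected S" "continuous_on S g" "\<And>x. x \<in> S \<Longrightarrow> exp (g x) = 1"
  shows "\<exists>j::int. \<forall>x\<in>S. g x = of_real (2 * pi) * \<i> * of_int j"
proof -
  have int: "\<exists>j::int. g x = of_real (2 * pi) * \<i> * of_int j" if x: "x \<in> S" for x
  proof -
    have "Re (g x) = 0" "\<exists>j::int. Im (g x) = of_int (2 * j) * pi"
      using assms(3)[OF x] by (auto simp: exp_eq_1)
    then obtain j :: int where "g x = of_real (2 * pi) * \<i> * of_int j"
      by (auto simp: complex_eq_iff)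
    then show ?thesis ..
  qed
  have "g constant_on S"
  proof (rule continuous_discrete_range_constant[OF assms(1,2)])
    fix x assume x: "x \<in> S"
    have "2 * pi \<le> norm (g y - g x)" if y: "y \<in> S" "g y \<noteq> g x" for y
    proof -
      obtain i j :: int where ij: "g x = of_real (2 * pi) * \<i> * of_int i" "g y = of_real (2 * pi) * \<i> * of_int j"
        using int[OF x] int[OF y(1)] by blast
      then have "g y - g x = of_real (2 * pi) * \<i> * of_int (j - i)"
        by (simp add: algebra_simps)
      then have "norm (g y - g x) = 2 * pi * \<bar>of_int (j - i)\<bar>"
        by (simp add: norm_mult del: of_int_diff)
      moreover have "1 \<le> \<bar>j - i\<bar>"
        using y(2) ij by auto
      then have "1 \<le> \<bar>of_int (j - i) :: real\<bar>"
        by linarith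
      ultimately show ?thesis
        using mult_left_mono[of 1 "\<bar>of_int (j - i) :: real\<bar>" "2 * pi"] by simp
    qed
    then show "\<exists>e>0. \<forall>y. y \<in> S \<and> g y \<noteq> g x \<longrightarrow> e \<le> norm (g y - g x)"
      by (intro exI[of _ "2 * pi"]) auto
  qed
  then obtain a where a: "\<And>x. x \<in> S \<Longrightarrow> g x = a"
    unfolding constant_on_def by blast
  show ?thesis
  proof (cases "S = {}")
    case False
    then obtain x where "x \<in> S" by blast
    with int a show ?thesis by metis
  qed simp
qed

definition real_vec :: "int ^ 'd \<Rightarrow> real ^ 'd" where
  "real_vec n = (\<chi> k. of_int (n $ k))"

lemma real_vec_nth [simp]: "real_vec n $ k = of_int (n $ k)"
  by (simp add: real_vec_def)

lemma real_vec_add: "real_vec (m + n) = real_vec m + real_vec n"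
  by (simp add: vec_eq_iff)

lemma torus_act_period: "torus_act ((2 * pi) *\<^sub>R real_vec n) x = x"
proof -
  have "cis (2 * pi * of_int j) = 1" "cis (- (2 * pi * of_int j)) = 1" for j
    by (simp_all add: cis_multiple_2pi flip: cis_cnj)
  then show ?thesis
    by (simp add: torus_act_def prod_eq_iff vec_eq_iff)
qed

lemma continuous_on_torus_act:
  assumes "continuous_on S f" "continuous_on S g"
  shows "continuous_on S (\<lambda>p. torus_act (f p) (g p))"
  unfolding torus_act_def by (intro continuous_intros assms continuous_on_cis)

text \<open>The isometry enters the lattice argument only through curves and their speed bounds, in
  both directions. Continuity of \<open>\<phi>\<close> is recorded separately because phases are
  lifted over a whole convex domain, not just along curves.\<close>

locale speed_isometry =
  fixes \<sigma>a \<sigma>b :: "real ^ 'd \<Rightarrow> real ^ 'd::finite" and \<phi> \<psi> :: "'d quat \<Rightarrow> 'd quat"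
  assumes lin_a: "linear \<sigma>a" and bij_a: "bij \<sigma>a" and lin_b: "linear \<sigma>b" and bij_b: "bij \<sigma>b"
    and \<phi>_\<psi> [simp]: "\<phi> (\<psi> y) = y" and \<psi>_\<phi> [simp]: "\<psi> (\<phi> x) = x"
    and continuous_\<phi>: "continuous_on UNIV \<phi>"
    and speed_\<phi>: "has_speed_le \<sigma>a c l \<Longrightarrow> has_speed_le \<sigma>b (\<lambda>t. \<phi> (c t)) l"
    and speed_\<psi>: "has_speed_le \<sigma>b c l \<Longrightarrow> has_speed_le \<sigma>a (\<lambda>t. \<psi> (c t)) l"
begin

lemma linear_inv: "linear (inv \<sigma>a)" "linear (inv \<sigma>b)"
  using lin_a bij_a lin_b bij_b by (metis bij_is_inj inj_linear_imp_inv_linear)+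

lemma \<sigma>_inv [simp]: "\<sigma>a (inv \<sigma>a v) = v" "\<sigma>b (inv \<sigma>b v) = v"
  using bij_a bij_b by (simp_all add: bij_is_surj surj_f_inv_f)

text \<open>Start with a point \<open>p\<close> that is very far in the source, push the small coordinates of \<open>\<phi> p\<close>
  outwards and pull back.  The push has bounded length and moment maps are Lipschitz, so \<open>q\<close> is
  still far.\<close>

lemma ex_far_points:
  assumes "0 < Y"
  shows "\<exists>q. \<forall>k. Y \<le> (coord_norm q k)\<^sup>2 \<and> Y \<le> (coord_norm (\<phi> q) k)\<^sup>2"
proof -
  obtain C where C: "C > 0"
    "\<And>x u B b. (\<And>k t. t \<in> {0..1} \<Longrightarrow> coord_norm (x + t *\<^sub>R u) k * coord_norm u k \<le> B) \<Longrightarrow>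
       (\<And>k. coord_norm u k \<le> b) \<Longrightarrow> has_speed_le \<sigma>b (\<lambda>t. x + t *\<^sub>R u) (C * B + C * b)"
    using straight_line_speed[OF lin_b] by blast
  obtain Ca where Ca: "Ca > 0"
    "\<And>x y. norm (torus_moment x - torus_moment y) \<le> Ca * norm (mu_sigma \<sigma>a x - mu_sigma \<sigma>a y)"
    using torus_moment_bounded_by_mu_sigma[OF lin_a bij_a] by blast
  \<comment> \<open>Speed of the push: moving coordinates keep size at most \<open>sqrt Y\<close>
    and are displaced by at most \<open>2 * sqrt Y\<close>; the others stay still.\<close>
  define R where "R = C * (2 * Y) + C * (2 * sqrt Y)"
  have "0 \<le> R"
    using C(1) assms by (simp add: R_def)
  \<comment> \<open>The first moment of \<open>p\<close> is \<open>- s^2 / 2\<close> in each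
    coordinate. A change by at most \<open>Ca * R\<close> then still forces squared size at least
    \<open>s^2 - 2 * (Ca * R) = Y\<close>.\<close>
  define s where "s = sqrt (Y + 2 * (Ca * R))"
  have s: "s\<^sup>2 = Y + 2 * (Ca * R)"
    using assms \<open>0 \<le> R\<close> Ca(1) by (simp add: s_def)
  define p :: "'d quat" where "p = (\<chi> k. of_real s, 0)"
  define x where "x = \<phi> p"
  \<comment> \<open>Moves each small coordinate to \<open>(sqrt Y, 0)\<close> and fixes the
    rest.\<close>
  define u where "u = ((\<chi> k. if Y \<le> (coord_norm x k)\<^sup>2 then 0 else of_real (sqrt Y) - fst x $ k) :: complex ^ 'd,
    (\<chi> k. if Y \<le> (coord_norm x k)\<^sup>2 then 0 else - snd x $ k) :: complex ^ 'd)"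
  have still: "coord_norm u k = 0" "coord_norm (x + t *\<^sub>R u) k = coord_norm x k"
    if "Y \<le> (coord_norm x k)\<^sup>2" for k t
    using that by (simp_all add: coord_norm_def u_def)
  have moved: "coord_norm (x + t *\<^sub>R u) k \<le> sqrt Y" "coord_norm u k \<le> 2 * sqrt Y"
    if t: "t \<in> {0..1}" and k: "\<not> Y \<le> (coord_norm x k)\<^sup>2" for k t
  proof -
    let ?X = "(fst x $ k, snd x $ k)" and ?e = "(of_real (sqrt Y), 0) :: complex \<times> complex"
    have X: "norm ?X \<le> sqrt Y"
      using k real_le_rsqrt[of "coord_norm x k" Y] by (simp add: coord_norm_def)
    have e: "norm ?e = sqrt Y"
      using assms by (simp add: norm_prod_def)
    have "coord_norm (x + t *\<^sub>R u) k = norm ((1 - t) *\<^sub>R ?X + t *\<^sub>R ?e)"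
      using k by (simp add: coord_norm_def u_def algebra_simps)
    also have "\<dots> \<le> norm ((1 - t) *\<^sub>R ?X) + norm (t *\<^sub>R ?e)"
      by (rule norm_triangle_ineq)
    also have "\<dots> = (1 - t) * norm ?X + t * sqrt Y"
      using t by (simp only: norm_scaleR e) simp
    also have "\<dots> \<le> (1 - t) * sqrt Y + t * sqrt Y"
      using t X by (intro add_mono mult_left_mono) auto
    finally show "coord_norm (x + t *\<^sub>R u) k \<le> sqrt Y"
      by (simp add: algebra_simps)
    have "coord_norm u k = norm (?e - ?X)"
      using k by (simp add: coord_norm_def u_def)
    then show "coord_norm u k \<le> 2 * sqrt Y"
      using norm_triangle_ineq4[of ?e ?X] X e by linarith
  qed
  have line: "has_speed_le \<sigma>b (\<lambda>t. x + t *\<^sub>R u) R"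
    unfolding R_def
  proof (rule C(2))
    fix k :: 'd and t :: real
    assume t: "t \<in> {0..1}"
    show "coord_norm (x + t *\<^sub>R u) k * coord_norm u k \<le> 2 * Y"
    proof (cases "Y \<le> (coord_norm x k)\<^sup>2")
      case False
      have "coord_norm (x + t *\<^sub>R u) k * coord_norm u k \<le> sqrt Y * (2 * sqrt Y)"
        using moved[OF t False] assms by (intro mult_mono) auto
      also have "\<dots> = 2 * Y"
        using assms by simp
      finally show ?thesis .
    qed (use still assms in simp)
  next
    show "coord_norm u k \<le> 2 * sqrt Y" for k
      using still[of k] moved(2)[of 0 k] assms by (cases "Y \<le> (coord_norm x k)\<^sup>2") auto
  qed
  define q where "q = \<psi> (x + u)"
  have "norm (mu_sigma \<sigma>a q - mu_sigma \<sigma>a p) \<le> R"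
    using mu_sigma_diff_le_speed[OF lin_a speed_\<psi>[OF line] \<open>0 \<le> R\<close>, of 0 1]
    by (simp add: q_def x_def)
  then have "Ca * norm (mu_sigma \<sigma>a q - mu_sigma \<sigma>a p) \<le> Ca * R"
    using Ca(1) by (intro mult_left_mono) auto
  then have dist: "norm (torus_moment q - torus_moment p) \<le> Ca * R"
    using Ca(2) order_trans by blast
  have "Y \<le> (coord_norm q k)\<^sup>2" for k
  proof -
    let ?m = "((cmod (snd q $ k))\<^sup>2 - (cmod (fst q $ k))\<^sup>2) / 2"
    have "\<bar>fst (torus_moment q - torus_moment p) $ k\<bar> \<le> Ca * R"
      using component_le_norm_cart[of "fst (torus_moment q - torus_moment p)" k] dist
        norm_fst_le[of "fst (torus_moment q - torus_moment p)" "snd (torus_moment q - torus_moment p)"]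
      unfolding prod.collapse by linarith
    then have "\<bar>?m + s\<^sup>2 / 2\<bar> \<le> Ca * R"
      by (simp add: torus_moment_def p_def)
    moreover have "- ?m \<le> (coord_norm q k)\<^sup>2 / 2"
      unfolding coord_norm_power2 minus_divide_left by (intro divide_right_mono) auto
    ultimately show ?thesis
      using s by linarith
  qed
  moreover have "Y \<le> (coord_norm (\<phi> q) k)\<^sup>2" for k
  proof (cases "Y \<le> (coord_norm x k)\<^sup>2")
    case True
    then show ?thesis
      using still(2)[of k 1] by (simp add: q_def)
  next
    case False
    then show ?thesis
      using assms by (simp add: q_def coord_norm_power2 u_def)
  qed
  ultimately show ?thesis by blast
qed

text \<open>The map \<open>(\<theta>, u) \<mapsto> torus_act \<theta> (q + u)\<close> from \<open>UNIV \<times> tube q \<kappa>\<close> replaces the universal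
  cover of a neighbourhood of the torus orbit of \<open>q\<close>; it is not injective modulo the period
  lattice, but its domain is convex.\<close>

definition tube :: "'d quat \<Rightarrow> real \<Rightarrow> 'd quat set" where
  "tube q \<kappa> = {u. \<forall>k. coord_norm u k * coord_norm q k \<le> \<kappa>}"

lemma convex_tube: "convex (tube q \<kappa>)"
proof (rule convexI)
  fix u v :: "'d quat" and s t :: real
  assume uv: "u \<in> tube q \<kappa>" "v \<in> tube q \<kappa>" and st: "0 \<le> s" "0 \<le> t" "s + t = 1"
  have "coord_norm (s *\<^sub>R u + t *\<^sub>R v) k * coord_norm q k \<le> \<kappa>" for k
  proof -
    have "coord_norm (s *\<^sub>R u + t *\<^sub>R v) k \<le> s * coord_norm u k + t * coord_norm v k"
      using coord_norm_triangle[of "s *\<^sub>R u" "t *\<^sub>R v" k] st by (simp add: coord_norm_scaleR)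
    then have "coord_norm (s *\<^sub>R u + t *\<^sub>R v) k * coord_norm q k \<le>
        (s * coord_norm u k + t * coord_norm v k) * coord_norm q k"
      by (intro mult_right_mono) auto
    also have "\<dots> = s * (coord_norm u k * coord_norm q k) + t * (coord_norm v k * coord_norm q k)"
      by (simp add: algebra_simps)
    also have "\<dots> \<le> s * \<kappa> + t * \<kappa>"
      using uv st unfolding tube_def by (intro add_mono mult_left_mono) auto
    finally show ?thesis
      using st by (simp flip: distrib_right)
  qed
  then show "s *\<^sub>R u + t *\<^sub>R v \<in> tube q \<kappa>"
    by (simp add: tube_def)
qed

text \<open>The bound does not depend on \<open>q\<close>, hence is small compared with the moments at far points.\<close>

lemma ex_tube_bound:
  assumes "0 \<le> \<kappa>"
  shows "\<exists>\<rho>\<ge>0. \<forall>q \<theta> u. (\<forall>k. 1 \<le> coord_norm q k) \<longrightarrow> u \<in> tube q \<kappa> \<longrightarrow>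
    norm (torus_moment (\<phi> (torus_act \<theta> (q + u))) - torus_moment (\<phi> q)) \<le> \<rho>"
proof -
  obtain C where C: "C > 0"
    "\<And>x u B b. (\<And>k t. t \<in> {0..1} \<Longrightarrow> coord_norm (x + t *\<^sub>R u) k * coord_norm u k \<le> B) \<Longrightarrow>
       (\<And>k. coord_norm u k \<le> b) \<Longrightarrow> has_speed_le \<sigma>a (\<lambda>t. x + t *\<^sub>R u) (C * B + C * b)"
    using straight_line_speed[OF lin_a] by blast
  obtain Cb where Cb: "Cb > 0"
    "\<And>x y. norm (torus_moment x - torus_moment y) \<le> Cb * norm (mu_sigma \<sigma>b x - mu_sigma \<sigma>b y)"
    using torus_moment_bounded_by_mu_sigma[OF lin_b bij_b] by blast
  obtain K where K: "K > 0" "\<And>v. norm (inv \<sigma>a v) \<le> K * norm v"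
    using linear_bounded_pos[OF linear_inv(1)] by blast
  \<comment> \<open>For coordinates of \<open>q\<close> of size at least 1, membership in the tube
    gives \<open>coord_norm u k\<close> at most \<open>\<kappa>\<close>, and position times
    displacement along the segment at most \<open>\<kappa> + \<kappa>^2\<close>.\<close>
  define R where "R = C * (\<kappa> + \<kappa>\<^sup>2) + C * \<kappa>"
  define T where "T = K * (of_nat CARD('d) * (2 * pi))"
  have "0 \<le> R" "0 \<le> T"
    using C(1) K(1) assms by (simp_all add: R_def T_def)
  have "norm (torus_moment (\<phi> (torus_act \<theta> (q + u))) - torus_moment (\<phi> q)) \<le> Cb * (R + T)"
    if q: "\<And>k. 1 \<le> coord_norm q k" and u: "u \<in> tube q \<kappa>" for q \<theta> u
  proof -
    have cu: "coord_norm u k * coord_norm q k \<le> \<kappa>" for k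
      using u by (simp add: tube_def)
    have cu1: "coord_norm u k \<le> \<kappa>" for k
      using order_trans[OF mult_left_mono[OF q coord_norm_nonneg] cu] by simp
    have line: "has_speed_le \<sigma>a (\<lambda>t. q + t *\<^sub>R u) R"
      unfolding R_def
    proof (rule C(2)[OF _ cu1])
      fix k :: 'd and t :: real
      assume t: "t \<in> {0..1}"
      have "coord_norm (q + t *\<^sub>R u) k \<le> coord_norm q k + t * coord_norm u k"
        using coord_norm_triangle[of q "t *\<^sub>R u" k] t by (simp add: coord_norm_scaleR)
      also have "\<dots> \<le> coord_norm q k + coord_norm u k"
        using t by (simp add: mult_left_le_one_le)
      finally have "coord_norm (q + t *\<^sub>R u) k * coord_norm u k \<le>
          (coord_norm q k + coord_norm u k) * coord_norm u k"
        by (intro mult_right_mono) auto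
      also have "\<dots> = coord_norm u k * coord_norm q k + (coord_norm u k)\<^sup>2"
        by (simp add: algebra_simps power2_eq_square)
      also have "\<dots> \<le> \<kappa> + \<kappa>\<^sup>2"
        using cu cu1 by (intro add_mono power_mono) auto
      finally show "coord_norm (q + t *\<^sub>R u) k * coord_norm u k \<le> \<kappa> + \<kappa>\<^sup>2" .
    qed
    have 1: "norm (mu_sigma \<sigma>b (\<phi> (q + u)) - mu_sigma \<sigma>b (\<phi> q)) \<le> R"
      using mu_sigma_diff_le_speed[OF lin_b speed_\<phi>[OF line] \<open>0 \<le> R\<close>, of 0 1] by simp
    \<comment> \<open>Reducing \<open>\<theta>\<close> modulo periods makes the connecting torus
      path of bounded length, uniformly in \<open>\<theta>\<close>.\<close>
    define n where "n = (\<chi> k. \<lfloor>\<theta> $ k / (2 * pi)\<rfloor>)"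
    define \<eta> where "\<eta> = \<theta> - (2 * pi) *\<^sub>R real_vec n"
    have "\<bar>\<eta> $ k\<bar> \<le> 2 * pi" for k
    proof -
      let ?r = "\<theta> $ k / (2 * pi)"
      have "\<eta> $ k = 2 * pi * (?r - of_int \<lfloor>?r\<rfloor>)"
        by (simp add: \<eta>_def n_def algebra_simps)
      moreover have "0 \<le> ?r - of_int \<lfloor>?r\<rfloor>" "?r - of_int \<lfloor>?r\<rfloor> \<le> 1"
        by linarith+
      ultimately show ?thesis
        by (simp add: abs_mult mult_left_le)
    qed
    then have "norm \<eta> \<le> of_nat CARD('d) * (2 * pi)"
      using order_trans[OF norm_le_l1_cart[of \<eta>] sum_bounded_above] by force
    then have speed: "norm (inv \<sigma>a \<eta>) \<le> T"
      using K unfolding T_def by (meson mult_left_mono order_trans less_imp_le)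
    have "torus_act \<theta> x = torus_act \<eta> x" for x
    proof -
      have "torus_act \<theta> x = torus_act \<eta> (torus_act ((2 * pi) *\<^sub>R real_vec n) x)"
        by (simp only: torus_act_add) (simp add: \<eta>_def)
      then show ?thesis
        by (simp only: torus_act_period)
    qed
    then have 2: "norm (mu_sigma \<sigma>b (\<phi> (torus_act \<theta> (q + u))) - mu_sigma \<sigma>b (\<phi> (q + u))) \<le> T"
      using mu_sigma_diff_le_speed[OF lin_b speed_\<phi>[OF has_speed_le_torus_orbit[OF lin_a]]
          norm_ge_zero, of 0 1 "inv \<sigma>a \<eta>" "q + u"] speed by simp
    have "norm (mu_sigma \<sigma>b (\<phi> (torus_act \<theta> (q + u))) - mu_sigma \<sigma>b (\<phi> q)) \<le> R + T"
      using norm_triangle_le[OF add_mono[OF 1 2]] by (simp add: algebra_simps)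
    then have "Cb * norm (mu_sigma \<sigma>b (\<phi> (torus_act \<theta> (q + u))) - mu_sigma \<sigma>b (\<phi> q)) \<le> Cb * (R + T)"
      using Cb(1) by (intro mult_left_mono) auto
    then show ?thesis
      using Cb(2) order_trans by blast
  qed
  moreover have "0 \<le> Cb * (R + T)"
    using Cb(1) \<open>0 \<le> R\<close> \<open>0 \<le> T\<close> by simp
  ultimately show ?thesis by blast
qed

text \<open>The map \<open>h\<close> records the phase change of the image under
  \<open>\<phi>\<close> of each closed torus orbit through \<open>q\<close>. Preimages come from the
  opposite direction: a closed torus orbit through \<open>\<phi> q\<close>, pulled back by
  \<open>\<psi>\<close>, has a phase change of its own around \<open>q\<close>, which is the
  required \<open>m\<close>.\<close>

lemma ex_lattice_map:
  fixes N :: "(int ^ 'd) set"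
  assumes "finite N" "0 < \<epsilon>"
  obtains h :: "int ^ 'd \<Rightarrow> int ^ 'd" where "\<And>m n. h (m + n) = h m + h n"
    "\<And>n. norm (inv \<sigma>b (real_vec (h n))) \<le> (1 + \<epsilon>) * norm (inv \<sigma>a (real_vec n))"
    "\<And>n. n \<in> N \<Longrightarrow> \<exists>m. h m = n \<and> norm (inv \<sigma>a (real_vec m)) \<le> (1 + \<epsilon>) * norm (inv \<sigma>b (real_vec n))"
proof -
  define period :: "int ^ 'd \<Rightarrow> real ^ 'd" where "period n = (2 * pi) *\<^sub>R real_vec n" for n
  have norm_period: "norm (inv \<sigma>a (period n)) = 2 * pi * norm (inv \<sigma>a (real_vec n))"
    "norm (inv \<sigma>b (period n)) = 2 * pi * norm (inv \<sigma>b (real_vec n))" for n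
    by (simp_all add: period_def linear_scale[OF linear_inv(1)] linear_scale[OF linear_inv(2)])
  have act_period: "torus_act (period n) x = x" for n and x :: "'d quat"
    unfolding period_def by (rule torus_act_period)
  have period_add: "period (m + n) = period m + period n" for m n
    by (simp add: period_def real_vec_add algebra_simps)
  obtain Ca where Ca: "Ca > 0"
    "\<And>x y. norm (torus_moment x - torus_moment y) \<le> Ca * norm (mu_sigma \<sigma>a x - mu_sigma \<sigma>a y)"
    using torus_moment_bounded_by_mu_sigma[OF lin_a bij_a] by blast
  obtain Da where Da: "Da > 0"
    "\<And>q Y l c L. Y > 0 \<Longrightarrow> (\<And>k. Y \<le> (coord_norm q k)\<^sup>2) \<Longrightarrow> 0 \<le> l \<Longrightarrow> has_speed_le \<sigma>a c l \<Longrightarrow>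
      (\<And>t k. t \<in> {0..1} \<Longrightarrow> (coord_norm q k)\<^sup>2 / 4 \<le> cmod (spin_prod q (c t) k)) \<Longrightarrow>
      (\<And>k. continuous_on {0..1} (\<lambda>t. L t k)) \<Longrightarrow>
      (\<And>t k. t \<in> {0..1} \<Longrightarrow> spin_prod q (c t) k = exp (L t k)) \<Longrightarrow>
      norm (inv \<sigma>a (\<chi> k. Im (L 1 k) - Im (L 0 k))) \<le> (1 + Da / sqrt Y) * l"
    using phase_shift_le_speed[OF lin_a bij_a] by blast
  obtain Db where Db: "Db > 0"
    "\<And>q Y l c L. Y > 0 \<Longrightarrow> (\<And>k. Y \<le> (coord_norm q k)\<^sup>2) \<Longrightarrow> 0 \<le> l \<Longrightarrow> has_speed_le \<sigma>b c l \<Longrightarrow>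
      (\<And>t k. t \<in> {0..1} \<Longrightarrow> (coord_norm q k)\<^sup>2 / 4 \<le> cmod (spin_prod q (c t) k)) \<Longrightarrow>
      (\<And>k. continuous_on {0..1} (\<lambda>t. L t k)) \<Longrightarrow>
      (\<And>t k. t \<in> {0..1} \<Longrightarrow> spin_prod q (c t) k = exp (L t k)) \<Longrightarrow>
      norm (inv \<sigma>b (\<chi> k. Im (L 1 k) - Im (L 0 k))) \<le> (1 + Db / sqrt Y) * l"
    using phase_shift_le_speed[OF lin_b bij_b] by blast
  \<comment> \<open>Constants fixed before \<open>q\<close>: \<open>l\<close> bounds the speed of
    every target loop for \<open>N\<close>, \<open>\<delta>\<close> the moment displacement of its
    pull-back, and \<open>\<kappa>\<close> is the resulting bound of
    \<open>coord_norm_diff_le_of_aligned\<close>.\<close>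
  define l where "l = (\<Sum>n\<in>N. norm (inv \<sigma>b (period n)))"
  have l: "norm (inv \<sigma>b (period n)) \<le> l" if "n \<in> N" for n
    unfolding l_def using that assms(1) by (intro member_le_sum) auto
  have "0 \<le> l"
    by (simp add: l_def sum_nonneg)
  define \<delta> where "\<delta> = Ca * l"
  have "0 \<le> \<delta>"
    using Ca(1) \<open>0 \<le> l\<close> by (simp add: \<delta>_def)
  define \<kappa> where "\<kappa> = 2 * \<delta>"
  have "0 \<le> \<kappa>"
    using \<open>0 \<le> \<delta>\<close> by (simp add: \<kappa>_def)
  obtain \<rho> where \<rho>: "0 \<le> \<rho>" "\<And>q \<theta> u. (\<And>k. 1 \<le> coord_norm q k) \<Longrightarrow> u \<in> tube q \<kappa> \<Longrightarrow>
      norm (torus_moment (\<phi> (torus_act \<theta> (q + u))) - torus_moment (\<phi> q)) \<le> \<rho>"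
    using ex_tube_bound[OF \<open>0 \<le> \<kappa>\<close>] by blast
  \<comment> \<open>The 1 serves \<open>ex_tube_bound\<close>, the terms with
    \<open>\<delta>\<close> and \<open>\<rho>\<close> serve \<open>norm_spin_prod_ge_quarter\<close>
    at \<open>q\<close> and at \<open>\<phi> q\<close>, and the squares push the speed errors below
    \<open>\<epsilon>\<close>.\<close>
  define Y where "Y = 1 + 4 * \<delta> + 4 * \<rho> + (Da / \<epsilon>)\<^sup>2 + (Db / \<epsilon>)\<^sup>2"
  have sq: "0 \<le> (Da / \<epsilon>)\<^sup>2" "0 \<le> (Db / \<epsilon>)\<^sup>2"
    by simp_all
  have Y: "1 \<le> Y" "4 * \<delta> \<le> Y" "4 * \<rho> \<le> Y" "(Da / \<epsilon>)\<^sup>2 \<le> Y" "(Db / \<epsilon>)\<^sup>2 \<le> Y"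
    unfolding Y_def using \<open>0 \<le> \<delta>\<close> \<open>0 \<le> \<rho>\<close> by simp_all
  have "0 < Y"
    using Y(1) by simp
  have small: "D / sqrt Y \<le> \<epsilon>" if "(D / \<epsilon>)\<^sup>2 \<le> Y" for D
    using real_le_rsqrt[OF that] \<open>0 < Y\<close> assms(2) by (simp add: divide_simps mult.commute)
  obtain q where q: "\<And>k. Y \<le> (coord_norm q k)\<^sup>2" "\<And>k. Y \<le> (coord_norm (\<phi> q) k)\<^sup>2"
    using ex_far_points[OF \<open>0 < Y\<close>] by blast
  have q1: "1 \<le> coord_norm q k" for k
    using order_trans[OF Y(1) q(1)] power2_le_imp_le[of 1 "coord_norm q k"] by simp
  define D where "D = (UNIV :: (real ^ 'd) set) \<times> tube q \<kappa>"
  define G where "G k p = spin_prod (\<phi> q) (\<phi> (torus_act (fst p) (q + snd p))) k" for k p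
  have "convex D"
    unfolding D_def by (intro convex_Times convex_tube convex_UNIV)
  have G_ge: "(coord_norm (\<phi> q) k)\<^sup>2 / 4 \<le> cmod (G k p)" if "p \<in> D" for k p
  proof -
    have "norm (torus_moment (\<phi> (torus_act (fst p) (q + snd p))) - torus_moment (\<phi> q)) \<le> \<rho>"
      using that by (intro \<rho>(2) q1) (auto simp: D_def)
    then show ?thesis
      unfolding G_def by (rule norm_spin_prod_ge_quarter) (rule order_trans[OF Y(3) q(2)])
  qed
  have G_nz: "G k p \<noteq> 0" if "p \<in> D" for k p
    using G_ge[OF that, of k] q(2)[of k] \<open>0 < Y\<close> by auto
  have cont_G: "continuous_on D (G k)" for k
  proof -
    have "continuous_on D (\<lambda>p. torus_act (fst p) (q + snd p))"
      by (intro continuous_on_torus_act continuous_intros)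
    then have "continuous_on D (\<lambda>p. \<phi> (torus_act (fst p) (q + snd p)))"
      by (rule continuous_on_compose2[OF continuous_\<phi>]) simp
    then show ?thesis
      unfolding G_def[abs_def] by (rule bounded_linear.continuous_on[OF bounded_linear_spin_prod])
  qed
  have "\<exists>F. continuous_on D F \<and> (\<forall>p\<in>D. G k p = exp (F p))" for k
    using continuous_logarithm_on_contractible[OF cont_G convex_imp_contractible[OF \<open>convex D\<close>] G_nz]
    by metis
  then obtain F where F: "\<And>k. continuous_on D (F k)" "\<And>k p. p \<in> D \<Longrightarrow> G k p = exp (F k p)"
    by metis
  define shift where "shift n p = (fst p + period n, snd p)" for n and p :: "(real ^ 'd) \<times> 'd quat"
  have shift_D: "shift n p \<in> D" if "p \<in> D" for n p
    using that by (auto simp: shift_def D_def)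
  have G_shift: "G k (shift n p) = G k p" for k n p
  proof -
    have "torus_act (fst p + period n) x = torus_act (fst p) x" for x :: "'d quat"
      using torus_act_add[of "fst p" "period n" x] by (simp add: act_period)
    then show ?thesis
      by (simp add: G_def shift_def)
  qed
  \<comment> \<open>The order of the difference offsets the minus sign in
    \<open>spin_prod_torus_act\<close>: for the identity map the integer would be
    \<open>n $ k\<close>.\<close>
  have ex_H: "\<exists>j::int. \<forall>p\<in>D. F k p - F k (shift n p) = of_real (2 * pi) * \<i> * of_int j" for n k
  proof (rule exp_eq_1_imp_constant)
    show "connected D"
      by (rule convex_connected[OF \<open>convex D\<close>])
    have "continuous_on D (shift n)"
      unfolding shift_def[abs_def] by (intro continuous_intros)
    then show "continuous_on D (\<lambda>p. F k p - F k (shift n p))"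
      using shift_D by (intro continuous_intros F(1) continuous_on_compose2[OF F(1)]) auto
    show "exp (F k p - F k (shift n p)) = 1" if "p \<in> D" for p
      using F(2)[OF that] F(2)[OF shift_D[OF that]] by (simp add: exp_diff G_shift)
  qed
  define H where
    "H n k = (SOME j::int. \<forall>p\<in>D. F k p - F k (shift n p) = of_real (2 * pi) * \<i> * of_int j)" for n k
  have H: "F k p - F k (shift n p) = of_real (2 * pi) * \<i> * of_int (H n k)" if "p \<in> D" for n k p
    using someI_ex[OF ex_H[of k n]] that unfolding H_def by blast
  define h where "h n = (\<chi> k. H n k)" for n
  have D0: "(\<theta>, 0) \<in> D" for \<theta>
    using \<open>0 \<le> \<kappa>\<close> by (simp add: D_def tube_def coord_norm_def zero_prod_def[symmetric])
  have H_inj: "i = j" if "of_real (2 * pi) * \<i> * of_int i = of_real (2 * pi) * \<i> * of_int j" for i j :: int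
    using that by simp
  show thesis
  proof (rule that[of h])
    show "h (m + n) = h m + h n" for m n
    proof -
      \<comment> \<open>Telescoping through the intermediate shift works because \<open>H\<close>
        does not depend on the point of \<open>D\<close>.\<close>
      have "H (m + n) k = H m k + H n k" for k
      proof (rule H_inj)
        let ?p = "(0, 0) :: (real ^ 'd) \<times> 'd quat"
        let ?a = "of_real (2 * pi) * \<i>"
        have "?a * of_int (H (m + n) k) = F k ?p - F k (shift (m + n) ?p)"
          by (rule H[OF D0, symmetric])
        also have "shift (m + n) ?p = shift n (shift m ?p)"
          by (simp add: shift_def period_add)
        also have "F k ?p - F k (shift n (shift m ?p)) =
            (F k ?p - F k (shift m ?p)) + (F k (shift m ?p) - F k (shift n (shift m ?p)))"
          by simp
        also have "\<dots> = ?a * of_int (H m k) + ?a * of_int (H n k)"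
          by (simp only: H[OF D0] H[OF shift_D[OF D0]])
        also have "\<dots> = ?a * of_int (H m k + H n k)"
          by (simp only: of_int_add distrib_left)
        finally show "?a * of_int (H (m + n) k) = ?a * of_int (H m k + H n k)" .
      qed
      then show ?thesis
        by (simp add: h_def vec_eq_iff)
    qed
  next
    fix n
    \<comment> \<open>Its norm bounds the speed of the closed orbit, and the phase of the image
      changes by \<open>- period (h n)\<close>.\<close>
    define \<tau> where "\<tau> = inv \<sigma>a (period n)"
    define c where "c t = torus_act (t *\<^sub>R \<sigma>a \<tau>) q" for t
    define L where "L t k = F k (t *\<^sub>R \<sigma>a \<tau>, 0)" for t k
    have spin_c: "spin_prod (\<phi> q) (\<phi> (c t)) k = G k (t *\<^sub>R \<sigma>a \<tau>, 0)" for t k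
      by (simp add: c_def G_def)
    have "norm (inv \<sigma>b (\<chi> k. Im (L 1 k) - Im (L 0 k))) \<le> (1 + Db / sqrt Y) * norm \<tau>"
    proof (rule Db(2)[OF \<open>0 < Y\<close> q(2) norm_ge_zero])
      show "has_speed_le \<sigma>b (\<lambda>t. \<phi> (c t)) (norm \<tau>)"
        unfolding c_def by (intro speed_\<phi> has_speed_le_torus_orbit lin_a)
      show "(coord_norm (\<phi> q) k)\<^sup>2 / 4 \<le> cmod (spin_prod (\<phi> q) (\<phi> (c t)) k)" for t k
        unfolding spin_c by (rule G_ge[OF D0])
      show "continuous_on {0..1} (\<lambda>t. L t k)" for k
        unfolding L_def using D0
        by (intro continuous_on_compose2[OF F(1)] continuous_intros) auto
      show "spin_prod (\<phi> q) (\<phi> (c t)) k = exp (L t k)" for t k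
        unfolding spin_c L_def by (rule F(2)[OF D0])
    qed
    moreover have "Im (L 1 k) - Im (L 0 k) = - (period (h n) $ k)" for k
    proof -
      have "L 0 k - L 1 k = of_real (2 * pi) * \<i> * of_int (H n k)"
        using H[OF D0, of k 0 n] by (simp add: L_def shift_def \<tau>_def)
      then have "Im (L 0 k - L 1 k) = 2 * pi * of_int (H n k)"
        by simp
      then show ?thesis
        by (simp add: period_def h_def)
    qed
    then have "(\<chi> k. Im (L 1 k) - Im (L 0 k)) = - period (h n)"
      by (simp add: vec_eq_iff)
    ultimately have "2 * pi * norm (inv \<sigma>b (real_vec (h n))) \<le>
        (1 + Db / sqrt Y) * (2 * pi * norm (inv \<sigma>a (real_vec n)))"
      by (simp add: linear_neg[OF linear_inv(2)] \<tau>_def norm_period)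
    also have "\<dots> \<le> (1 + \<epsilon>) * (2 * pi * norm (inv \<sigma>a (real_vec n)))"
      using small[OF Y(5)] by (intro mult_right_mono) auto
    finally show "norm (inv \<sigma>b (real_vec (h n))) \<le> (1 + \<epsilon>) * norm (inv \<sigma>a (real_vec n))"
      by simp
  next
    fix n
    assume "n \<in> N"
    define \<tau> where "\<tau> = inv \<sigma>b (period n)"
    define c where "c t = torus_act (t *\<^sub>R \<sigma>b \<tau>) (\<phi> q)" for t
    define e where "e t = \<psi> (c t)" for t
    have "\<sigma>b \<tau> = period n"
      by (simp add: \<tau>_def)
    have e01: "e 0 = q" "e 1 = q"
      by (simp_all add: e_def c_def \<open>\<sigma>b \<tau> = period n\<close> act_period)
    have speed_e: "has_speed_le \<sigma>a e (norm \<tau>)"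
      unfolding e_def[abs_def] c_def by (intro speed_\<psi> has_speed_le_torus_orbit lin_b)
    have near: "norm (torus_moment (e t) - torus_moment q) \<le> \<delta>" if "t \<in> {0..1}" for t
    proof -
      have "norm (mu_sigma \<sigma>a (e t) - mu_sigma \<sigma>a q) \<le> l"
        using mu_sigma_diff_le_speed[OF lin_a speed_e norm_ge_zero _ that, of 0] l[OF \<open>n \<in> N\<close>]
        by (simp add: e01 \<tau>_def)
      then show ?thesis
        unfolding \<delta>_def using Ca order_trans[OF Ca(2) mult_left_mono] by (metis less_imp_le)
    qed
    have spin_ge: "(coord_norm q k)\<^sup>2 / 4 \<le> cmod (spin_prod q (e t) k)" if "t \<in> {0..1}" for t k
      using near[OF that] by (rule norm_spin_prod_ge_quarter) (rule order_trans[OF Y(2) q(1)])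
    have spin_nz: "spin_prod q (e t) k \<noteq> 0" if "t \<in> {0..1}" for t k
      using spin_ge[OF that, of k] q(1)[of k] \<open>0 < Y\<close> by auto
    have cont_e: "continuous_on {0..1} e"
      by (rule has_speed_le_imp_continuous_on[OF speed_e])
    have cont_spin: "continuous_on {0..1} (\<lambda>t. spin_prod q (e t) k)" for k
      using cont_e by (rule bounded_linear.continuous_on[OF bounded_linear_spin_prod])
    have "\<exists>L. continuous_on {0..1} L \<and> (\<forall>t\<in>{0..1}. spin_prod q (e t) k = exp (L t))" for k
      using continuous_logarithm_on_contractible[OF cont_spin convex_imp_contractible spin_nz]
      by (metis convex_real_interval(5))
    then obtain L where L: "\<And>k. continuous_on {0..1} (L k)"
      "\<And>k t. t \<in> {0..1} \<Longrightarrow> spin_prod q (e t) k = exp (L k t)"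
      by metis
    \<comment> \<open>Undoing the rotation by \<open>\<theta> t\<close> aligns the phase of
      \<open>e t\<close> with that of \<open>q\<close>, so the remainder \<open>u t\<close> lies in
      the tube and \<open>(\<theta> t, u t)\<close> is a lift of the loop \<open>e\<close> to
      \<open>D\<close>.\<close>
    define \<theta> where "\<theta> t = (\<chi> k. Im (L k 0) - Im (L k t))" for t
    define u where "u t = torus_act (- \<theta> t) (e t) - q" for t
    have polar: "exp (L k t) = of_real (cmod (exp (L k t))) * cis (Im (L k t))" for k t
      by (subst norm_exp_eq_Re) (rule exp_eq_polar)
    have "cis (Im (L k 0)) = 1" for k
    proof -
      have "exp (L k 0) = of_real ((coord_norm q k)\<^sup>2)"
        using L(2)[of 0 k] by (simp add: e01 spin_prod_self)
      then have "of_real ((coord_norm q k)\<^sup>2) = of_real ((coord_norm q k)\<^sup>2) * cis (Im (L k 0))"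
        using polar[of k 0] by (simp del: of_real_power)
      moreover have "coord_norm q k \<noteq> 0"
        using q1[of k] by auto
      ultimately show ?thesis
        by simp
    qed
    then have spin_rotated: "spin_prod q (torus_act (- \<theta> t) (e t)) k = of_real (cmod (exp (L k t)))"
      if "t \<in> {0..1}" for t k
    proof -
      have "spin_prod q (torus_act (- \<theta> t) (e t)) k =
          of_real (cmod (exp (L k t))) * (cis (\<theta> t $ k) * cis (Im (L k t)))"
        unfolding spin_prod_torus_act L(2)[OF that] by (subst polar) simp
      also have "cis (\<theta> t $ k) * cis (Im (L k t)) = 1"
        using \<open>cis (Im (L k 0)) = 1\<close> by (simp add: cis_mult \<theta>_def)
      finally show ?thesis by simp
    qed
    have u_tube: "u t \<in> tube q \<kappa>" if "t \<in> {0..1}" for t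
    proof -
      have "norm (torus_moment (torus_act (- \<theta> t) (e t)) - torus_moment q) \<le> \<delta>"
        unfolding torus_moment_torus_act by (rule near[OF that])
      then have "coord_norm (u t) k * coord_norm q k \<le> 2 * \<delta>" for k
        unfolding u_def
        by (rule coord_norm_diff_le_of_aligned) (simp add: spin_rotated[OF that])
      then show ?thesis
        by (simp add: tube_def \<kappa>_def)
    qed
    have lift: "torus_act (\<theta> t) (q + u t) = e t" for t
      by (simp add: u_def)
    \<comment> \<open>Along the lift, \<open>F\<close> is a logarithm of the spin product of
      \<open>c t\<close> with \<open>\<phi> q\<close>, whose phase is exactly
      \<open>- t * period n\<close>. Adding this back leaves a continuous logarithm of a positive
      constant. Comparing the ends \<open>(0, 0)\<close> and \<open>(period m, 0)\<close> of the
      lift then identifies \<open>h m\<close> with \<open>n\<close>.\<close>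
    define g where "g k t = F k (\<theta> t, u t) + \<i> * of_real (t * period n $ k)" for k t
    have cont_\<theta>: "continuous_on {0..1} \<theta>"
      unfolding \<theta>_def[abs_def] by (intro continuous_intros L(1))
    have g_const: "g k 1 = g k 0" for k
    proof -
      have "\<exists>j::int. \<forall>t\<in>{0..1::real}. g k t - g k 0 = of_real (2 * pi) * \<i> * of_int j"
      proof (rule exp_eq_1_imp_constant)
        have "continuous_on {0..1} u"
          unfolding u_def[abs_def]
          by (intro continuous_intros continuous_on_torus_act cont_\<theta> cont_e)
        then show "continuous_on {0..1} (\<lambda>t. g k t - g k 0)"
          unfolding g_def using u_tube cont_\<theta>
          by (intro continuous_intros continuous_on_compose2[OF F(1)]) (auto simp: D_def)
        have "exp (g k t) = of_real ((coord_norm (\<phi> q) k)\<^sup>2)" if t: "t \<in> {0..1}" for t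
        proof -
          have "exp (F k (\<theta> t, u t)) = G k (\<theta> t, u t)"
            using F(2) u_tube[OF t] by (simp add: D_def)
          also have "\<dots> = spin_prod (\<phi> q) (c t) k"
            by (simp add: G_def lift) (simp add: e_def)
          also have "\<dots> = cis (- (t * period n $ k)) * of_real ((coord_norm (\<phi> q) k)\<^sup>2)"
            by (simp add: c_def spin_prod_torus_act spin_prod_self \<open>\<sigma>b \<tau> = period n\<close>)
          finally have F_t: "exp (F k (\<theta> t, u t)) =
              cis (- (t * period n $ k)) * of_real ((coord_norm (\<phi> q) k)\<^sup>2)" .
          have "cis (- s) * of_real r * cis s = of_real r" for r s
            by (simp add: cis_mult mult.assoc mult.left_commute[of "cis _"])
          then show ?thesis
            unfolding g_def exp_add cis_conv_exp[symmetric] F_t .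
        qed
        moreover have "coord_norm (\<phi> q) k \<noteq> 0"
          using q(2)[of k] \<open>0 < Y\<close> by auto
        ultimately show "exp (g k t - g k 0) = 1" if "t \<in> {0..1}" for t
          using that by (simp add: exp_diff)
      qed (rule connected_Icc)
      then obtain j :: int where j: "\<And>t. t \<in> {0..1::real} \<Longrightarrow> g k t - g k 0 = of_real (2 * pi) * \<i> * of_int j"
        by blast
      from j[of 0] j[of 1] show ?thesis by simp
    qed
    have "\<exists>m::int. L k 0 - L k 1 = of_real (2 * pi) * \<i> * of_int m" for k
    proof -
      have "exp (L k 0 - L k 1) = 1"
        using L(2)[of 0 k] L(2)[of 1 k] by (simp add: exp_diff e01)
      \<comment> \<open>The singleton is a dummy connected domain for a constant function.\<close>
      then have "\<exists>m::int. \<forall>x\<in>{0::real}. L k 0 - L k 1 = of_real (2 * pi) * \<i> * of_int m"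
        by (intro exp_eq_1_imp_constant) auto
      then show ?thesis by blast
    qed
    then obtain M where M: "\<And>k. L k 0 - L k 1 = of_real (2 * pi) * \<i> * of_int (M k)"
      by metis
    define m where "m = (\<chi> k. M k)"
    have \<theta>1: "\<theta> 1 = period m"
    proof -
      have "Im (L k 0) - Im (L k 1) = 2 * pi * of_int (M k)" for k
        using arg_cong[OF M[of k], of Im] by simp
      then show ?thesis
        by (simp add: \<theta>_def period_def m_def vec_eq_iff)
    qed
    have "torus_act (- period m) q = q"
      using torus_act_inverse(2)[of "period m" q] by (simp only: act_period)
    then have u01: "u 0 = 0" "u 1 = 0" and \<theta>0: "\<theta> 0 = 0"
      by (simp_all add: u_def \<theta>1 e01 \<theta>_def[of 0] flip: zero_vec_def)
    have "h m = n"
    proof -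
      have "H m k = n $ k" for k
      proof (rule H_inj)
        have "F k (0, 0) - F k (period m, 0) = \<i> * of_real (period n $ k)"
          using g_const[of k] by (simp add: g_def u01 \<theta>0 \<theta>1 algebra_simps)
        then show "of_real (2 * pi) * \<i> * of_int (H m k) = of_real (2 * pi) * \<i> * of_int (n $ k)"
          using H[OF D0, of k 0 m] by (simp add: shift_def period_def mult_ac)
      qed
      then show ?thesis
        by (simp add: h_def vec_eq_iff)
    qed
    moreover have "norm (inv \<sigma>a (\<chi> k. Im (L k 1) - Im (L k 0))) \<le> (1 + Da / sqrt Y) * norm \<tau>"
      using Da(2)[OF \<open>0 < Y\<close> q(1) norm_ge_zero speed_e spin_ge, of "\<lambda>t k. L k t"] L by simp
    moreover have "(\<chi> k. Im (L k 1) - Im (L k 0)) = - period m"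
      unfolding \<theta>1[symmetric] by (simp add: \<theta>_def vec_eq_iff)
    ultimately have "h m = n" "2 * pi * norm (inv \<sigma>a (real_vec m)) \<le>
        (1 + Da / sqrt Y) * (2 * pi * norm (inv \<sigma>b (real_vec n)))"
      by (simp_all add: linear_neg[OF linear_inv(1)] \<tau>_def norm_period)
    note this(2)
    also have "(1 + Da / sqrt Y) * (2 * pi * norm (inv \<sigma>b (real_vec n))) \<le>
        (1 + \<epsilon>) * (2 * pi * norm (inv \<sigma>b (real_vec n)))"
      using small[OF Y(4)] by (intro mult_right_mono) auto
    finally show "\<exists>m. h m = n \<and> norm (inv \<sigma>a (real_vec m)) \<le> (1 + \<epsilon>) * norm (inv \<sigma>b (real_vec n))"
      using \<open>h m = n\<close> by (intro exI[of _ m]) simp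
  qed
qed

end

section \<open>Isometries preserve speed\<close>

lemma smooth_map_has_derivative:
  assumes "smooth_map f"
  shows "(f has_derivative frechet_derivative f (at x)) (at x)"
proof -
  have "C_diff (Suc 0) f"
    using assms unfolding smooth_map_def by blast
  then show ?thesis
    by (simp flip: frechet_derivative_works)
qed

lemma has_speed_le_compose:
  assumes f: "smooth_map f"
    and iso: "\<And>x u. g_TN \<sigma>' (f x) (frechet_derivative f (at x) u) (frechet_derivative f (at x) u) = g_TN \<sigma> x u u"
    and c: "has_speed_le \<sigma> c l"
  shows "has_speed_le \<sigma>' (\<lambda>t. f (c t)) l"
proof -
  obtain c' where c': "\<And>t. t \<in> {0..1} \<Longrightarrow> (c has_vector_derivative c' t) (at t within {0..1})"
    "\<And>t. t \<in> {0..1} \<Longrightarrow> g_TN \<sigma> (c t) (c' t) (c' t) \<le> l\<^sup>2"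
    using c unfolding has_speed_le_def by blast
  have "((\<lambda>t. f (c t)) has_vector_derivative frechet_derivative f (at (c t)) (c' t)) (at t within {0..1})"
    if "t \<in> {0..1}" for t
    using vector_derivative_diff_chain_within[OF c'(1)[OF that]
        has_derivative_at_withinI[OF smooth_map_has_derivative[OF f]]]
    by (simp add: o_def)
  then show ?thesis
    unfolding has_speed_le_def using c'(2) iso
    by (intro exI[of _ "\<lambda>t. frechet_derivative f (at (c t)) (c' t)"]) auto
qed

text \<open>The metric condition for the inverse comes from differentiating
  \<open>f \<circ> inv f = id\<close>.\<close>

lemma isometric_imp_speed_isometry:
  fixes \<sigma> \<sigma>' :: "real ^ 'd \<Rightarrow> real ^ 'd::finite"
  assumes lin: "linear \<sigma>" "bij \<sigma>" "linear \<sigma>'" "bij \<sigma>'" and iso: "isometric (g_TN \<sigma>) (g_TN \<sigma>')"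
  shows "\<exists>\<phi> \<psi>. speed_isometry \<sigma> \<sigma>' \<phi> \<psi>"
proof -
  obtain f where f: "bij f" "smooth_map f" "smooth_map (inv f)" and g:
    "\<And>x u. g_TN \<sigma>' (f x) (frechet_derivative f (at x) u) (frechet_derivative f (at x) u) = g_TN \<sigma> x u u"
    using iso unfolding isometric_def diffeo_def by blast
  have f_inv: "f (inv f y) = y" "inv f (f x) = x" for x y
    using f(1) by (simp_all add: bij_is_surj surj_f_inv_f bij_is_inj)
  have g': "g_TN \<sigma> (inv f y) (frechet_derivative (inv f) (at y) v) (frechet_derivative (inv f) (at y) v) =
      g_TN \<sigma>' y v v" for y v
  proof -
    have "f \<circ> inv f = id"
      by (simp add: fun_eq_iff f_inv)
    then have "(id has_derivative frechet_derivative f (at (inv f y)) \<circ> frechet_derivative (inv f) (at y)) (at y)"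
      using diff_chain_at[OF smooth_map_has_derivative[OF f(3)] smooth_map_has_derivative[OF f(2)], of y]
      by simp
    from fun_cong[OF has_derivative_unique[OF this has_derivative_id], of v]
    have "frechet_derivative f (at (inv f y)) (frechet_derivative (inv f) (at y) v) = v"
      by simp
    then show ?thesis
      using g[of "inv f y" "frechet_derivative (inv f) (at y) v"] by (simp add: f_inv)
  qed
  have "continuous_on UNIV f"
    by (intro continuous_at_imp_continuous_on ballI has_derivative_continuous[OF smooth_map_has_derivative[OF f(2)]])
  then have "speed_isometry \<sigma> \<sigma>' f (inv f)"
    by (intro speed_isometry.intro lin f_inv has_speed_le_compose[OF f(2) g]
        has_speed_le_compose[OF f(3) g'])
  then show ?thesis by blast
qed

section \<open>Integral matrices and double cosets\<close>

lemma additive_int_vec_eq_matrix: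
  fixes h :: "int ^ 'n::finite \<Rightarrow> int ^ 'm::finite"
  assumes add: "\<And>m n. h (m + n) = h m + h n"
  shows "h n = (\<chi> i j. h (axis j 1) $ i) *v n"
proof -
  interpret additive h
    by standard (rule add)
  have scale: "h (a *s v) = a *s h v" for a v
  proof (induction a rule: int_induct[where k = 0])
    case base
    then show ?case by (simp add: zero)
  next
    case (step1 i)
    then show ?case by (simp add: vector_sadd_rdistrib add)
  next
    case (step2 i)
    have "(i - 1) *s v = i *s v - v" for v :: "int ^ 'k"
      by (simp add: vec_eq_iff algebra_simps)
    with step2 show ?case by (simp add: diff)
  qed
  have "h n = h (\<Sum>j\<in>UNIV. (n $ j) *s axis j 1)"
    by (simp only: basis_expansion)
  also have "\<dots> = (\<Sum>j\<in>UNIV. (n $ j) *s h (axis j 1))"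
    by (simp only: sum scale)
  also have "\<dots> = (\<chi> i j. h (axis j 1) $ i) *v n"
    by (simp add: vec_eq_iff matrix_vector_mult_def mult.commute)
  finally show ?thesis .
qed

lemma map_matrix_of_int_mult:
  "map_matrix of_int (A ** B) = map_matrix (of_int :: int \<Rightarrow> 'a::ring_1) A ** map_matrix of_int B"
  by (simp add: vec_eq_iff matrix_matrix_mult_def)

lemma map_matrix_of_int_mat_1: "map_matrix of_int (mat 1) = (mat 1 :: 'a::ring_1 ^ 'n ^ 'n)"
  by (simp add: vec_eq_iff mat_def)

text \<open>True over the field of reals, and the entrywise embedding of the integers is
  injective.\<close>

lemma int_matrix_left_right_inverse:
  fixes A B :: "int ^ 'n ^ 'n::finite"
  assumes "A ** B = mat 1"
  shows "B ** A = mat 1"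
proof -
  let ?r = "map_matrix real_of_int :: int ^ 'n ^ 'n \<Rightarrow> _"
  have "?r A ** ?r B = mat 1"
    using arg_cong[OF assms, of ?r] by (simp only: map_matrix_of_int_mult map_matrix_of_int_mat_1)
  then have "?r (B ** A) = ?r (mat 1)"
    by (simp only: map_matrix_of_int_mult map_matrix_of_int_mat_1 matrix_left_right_inverse)
  then show ?thesis
    by (simp add: vec_eq_iff)
qed

lemma real_vec_matrix: "real_vec (A *v n) = map_matrix real_of_int A *v real_vec n"
  by (simp add: vec_eq_iff matrix_vector_mult_def)

lemma finite_bounded_int_matrices:
  "finite {A :: int ^ 'n ^ 'm. \<forall>i j. \<bar>A $ i $ j\<bar> \<le> Z}"
proof -
  have "{A :: int ^ 'n ^ 'm. \<forall>i j. \<bar>A $ i $ j\<bar> \<le> Z} \<subseteq>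
      (\<lambda>f. \<chi> i j. f (i, j)) ` (PiE UNIV (\<lambda>_. {- Z..Z}))"
  proof
    fix A :: "int ^ 'n ^ 'm"
    assume "A \<in> {A. \<forall>i j. \<bar>A $ i $ j\<bar> \<le> Z}"
    then have "- Z \<le> A $ i $ j \<and> A $ i $ j \<le> Z" for i j
      by (simp add: abs_le_iff minus_le_iff)
    then have "(\<lambda>(i, j). A $ i $ j) \<in> PiE UNIV (\<lambda>_. {- Z..Z})"
      by (simp add: PiE_def Pi_def)
    moreover have "A = (\<chi> i j. (\<lambda>(i, j). A $ i $ j) (i, j))"
      by (simp add: vec_eq_iff)
    ultimately show "A \<in> (\<lambda>f. \<chi> i j. f (i, j)) ` (PiE UNIV (\<lambda>_. {- Z..Z}))"
      by blast
  qed
  then show ?thesis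
    by (rule finite_subset) (intro finite_imageI finite_PiE; simp)
qed

lemma GL_int_mult:
  assumes "A \<in> GL_int" "B \<in> GL_int"
  shows "A ** B \<in> GL_int"
proof -
  obtain P Q where "A = map_matrix real_of_int P" "invertible P" "B = map_matrix real_of_int Q" "invertible Q"
    using assms unfolding GL_int_def by blast
  then show ?thesis
    unfolding GL_int_def using invertible_mult[of P Q]
    by (auto simp flip: map_matrix_of_int_mult)
qed

lemma GL_int_inverse:
  assumes "A \<in> GL_int"
  obtains A' where "A' \<in> GL_int" "A' ** A = mat 1"
proof -
  obtain P P' where P: "A = map_matrix real_of_int P" "P ** P' = mat 1" "P' ** P = mat 1"
    using assms unfolding GL_int_def invertible_def by blast
  then have "invertible P'"
    unfolding invertible_def by blast
  moreover have "map_matrix real_of_int P' ** A = mat 1"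
    by (simp only: P map_matrix_of_int_mult[symmetric] map_matrix_of_int_mat_1)
  ultimately show thesis
    using that unfolding GL_int_def by blast
qed

lemma double_coset_eqI:
  assumes "M = A ** N ** B" "A \<in> GL_int" "orthogonal_matrix B"
  shows "double_coset M = double_coset N"
proof -
  have sub: "double_coset (A ** N ** B) \<subseteq> double_coset N"
    if "A \<in> GL_int" "orthogonal_matrix B" for A N B :: "real ^ 'a ^ 'a"
  proof
    fix X assume "X \<in> double_coset (A ** N ** B)"
    then obtain A' B' where X: "X = A' ** (A ** N ** B) ** B'" "A' \<in> GL_int" "orthogonal_matrix B'"
      unfolding double_coset_def by blast
    then have "X = (A' ** A) ** N ** (B ** B')"
      by (simp add: matrix_mul_assoc)
    then show "X \<in> double_coset N"
      unfolding double_coset_def using X that GL_int_mult orthogonal_matrix_mul by blast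
  qed
  obtain A' where A': "A' \<in> GL_int" "A' ** A = mat 1"
    using GL_int_inverse[OF assms(2)] .
  have "A' ** M ** transpose B = (A' ** A) ** N ** (B ** transpose B)"
    by (simp add: assms(1) matrix_mul_assoc)
  also have "\<dots> = N"
    using A'(2) assms(3) by (simp add: orthogonal_matrix_def)
  finally have "N = A' ** M ** transpose B" ..
  then show ?thesis
    using sub[OF assms(2,3)] sub[OF A'(1), of "transpose B"] assms(1,3)
    by (metis orthogonal_matrix_transpose subset_antisym)
qed

section \<open>From approximate to exact isometries of the lattices\<close>

context speed_isometry
begin

text \<open>By polarisation, the lengths of these vectors determine a Gram matrix.\<close>

definition test_vecs :: "(int ^ 'd) set" where
  "test_vecs = range (\<lambda>i. axis i 1) \<union> range (\<lambda>(i, j). axis i 1 + axis j 1)"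

lemma finite_test_vecs: "finite test_vecs"
  by (simp add: test_vecs_def)

text \<open>\<open>P\<close> goes from the lattice of \<open>\<sigma>b\<close> to that of
  \<open>\<sigma>a\<close>, against the lattice map, because \<open>ex_lattice_map\<close> controls
  preimages of prescribed target vectors.\<close>

definition near_isometry :: "real \<Rightarrow> int ^ 'd ^ 'd \<Rightarrow> bool" where
  "near_isometry \<epsilon> P \<longleftrightarrow> (\<forall>n\<in>test_vecs.
     norm (inv \<sigma>a (real_vec (P *v n))) \<le> (1 + \<epsilon>) * norm (inv \<sigma>b (real_vec n)) \<and>
     norm (inv \<sigma>b (real_vec n)) \<le> (1 + \<epsilon>) * norm (inv \<sigma>a (real_vec (P *v n))))"

text \<open>Preimages of the axis vectors are the columns of a right inverse \<open>P\<close> of the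
  matrix of \<open>h\<close>. As \<open>P\<close> is two-sided, the short preimage of any test
  vector \<open>n\<close> must be \<open>P *v n\<close>, so its length bound applies to
  \<open>P\<close>.\<close>

lemma ex_near_isometry:
  assumes "0 < \<epsilon>"
  shows "\<exists>P. invertible P \<and> near_isometry \<epsilon> P"
proof -
  obtain h :: "int ^ 'd \<Rightarrow> int ^ 'd" where add: "\<And>m n. h (m + n) = h m + h n"
    and ub: "\<And>n. norm (inv \<sigma>b (real_vec (h n))) \<le> (1 + \<epsilon>) * norm (inv \<sigma>a (real_vec n))"
    and ex: "\<And>n. n \<in> test_vecs \<Longrightarrow> \<exists>m. h m = n \<and> norm (inv \<sigma>a (real_vec m)) \<le> (1 + \<epsilon>) * norm (inv \<sigma>b (real_vec n))"
    using ex_lattice_map[OF finite_test_vecs assms] by blast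
  define H where "H = (\<chi> i j. h (axis j 1) $ i)"
  have H: "h n = H *v n" for n
    unfolding H_def by (rule additive_int_vec_eq_matrix[OF add])
  have "axis j 1 \<in> test_vecs" for j
    by (simp add: test_vecs_def)
  then have "\<forall>j. \<exists>m. h m = axis j 1"
    using ex by blast
  then obtain p where p: "\<And>j. h (p j) = axis j 1"
    by metis
  define P where "P = (\<chi> i j. p j $ i)"
  have "H ** P = mat 1"
  proof -
    have "(H ** P) $ i $ j = (H *v p j) $ i" for i j
      by (simp add: matrix_matrix_mult_def matrix_vector_mult_def P_def)
    then show ?thesis
      by (simp add: vec_eq_iff mat_def axis_def p flip: H)
  qed
  then have PH: "P ** H = mat 1"
    by (rule int_matrix_left_right_inverse)
  have "near_isometry \<epsilon> P"
    unfolding near_isometry_def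
  proof
    fix n assume "n \<in> test_vecs"
    then obtain m where m: "h m = n" "norm (inv \<sigma>a (real_vec m)) \<le> (1 + \<epsilon>) * norm (inv \<sigma>b (real_vec n))"
      using ex by blast
    have "P *v n = m"
      using m(1) PH by (auto simp: H matrix_vector_mul_assoc)
    then show "norm (inv \<sigma>a (real_vec (P *v n))) \<le> (1 + \<epsilon>) * norm (inv \<sigma>b (real_vec n)) \<and>
        norm (inv \<sigma>b (real_vec n)) \<le> (1 + \<epsilon>) * norm (inv \<sigma>a (real_vec (P *v n)))"
      using m ub[of m] by simp
  qed
  then show ?thesis
    using \<open>H ** P = mat 1\<close> PH unfolding invertible_def by blast
qed

text \<open>The columns of \<open>P\<close> are images of axis vectors; a bound on their norm under
  \<open>inv \<sigma>a\<close> bounds their integral entries.\<close>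

lemma finite_near_isometry: "finite {P. near_isometry 1 P}"
proof -
  obtain K where K: "K > 0" "\<And>v. norm (\<sigma>a v) \<le> K * norm v"
    using linear_bounded_pos[OF lin_a] by blast
  define B where "B = (\<Sum>j\<in>UNIV. K * (2 * norm (inv \<sigma>b (real_vec (axis j 1 :: int ^ 'd)))))"
  have "\<bar>P $ i $ j\<bar> \<le> \<lfloor>B\<rfloor>" if "near_isometry 1 P" for P i j
  proof -
    let ?v = "real_vec (P *v axis j 1)"
    have "norm ?v \<le> K * norm (inv \<sigma>a ?v)"
      using K(2)[of "inv \<sigma>a ?v"] by simp
    also have "norm (inv \<sigma>a ?v) \<le> 2 * norm (inv \<sigma>b (real_vec (axis j 1 :: int ^ 'd)))"
      using that unfolding near_isometry_def test_vecs_def by auto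
    then have "K * norm (inv \<sigma>a ?v) \<le> K * (2 * norm (inv \<sigma>b (real_vec (axis j 1 :: int ^ 'd))))"
      using K(1) by (intro mult_left_mono) auto
    also have "\<dots> \<le> B"
      unfolding B_def using K(1) by (intro member_le_sum) auto
    finally have "norm ?v \<le> B" .
    moreover have "?v $ i = of_int (P $ i $ j)"
      by (simp add: matrix_vector_mult_def axis_def if_distrib cong: if_cong)
    ultimately have "\<bar>of_int (P $ i $ j)\<bar> \<le> B"
      using component_le_norm_cart[of ?v i] by simp
    then show ?thesis
      by (simp add: le_floor_iff)
  qed
  then show ?thesis
    by (intro finite_subset[OF _ finite_bounded_int_matrices[of "\<lfloor>B\<rfloor>"]]) auto
qed

text \<open>An inexact candidate violates some inequality strictly, hence also for all small
  \<epsilon>. If all candidates were inexact, one \<epsilon> below 1 would exclude the whole finite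
  set, although a near isometry for that \<epsilon> belongs to it.\<close>

lemma ex_exact_isometry: "\<exists>P. invertible P \<and> near_isometry 0 P"
proof (rule ccontr)
  assume no: "\<not> ?thesis"
  let ?S = "{P. invertible P \<and> near_isometry 1 P}"
  have ev: "eventually (\<lambda>\<epsilon>. \<not> near_isometry \<epsilon> P) (at_right 0)" if "P \<in> ?S" for P
  proof -
    have *: "eventually (\<lambda>\<epsilon>. \<not> a \<le> (1 + \<epsilon>) * b) (at_right 0)" if "b < a" for a b :: real
    proof -
      have "((\<lambda>\<epsilon>. (1 + \<epsilon>) * b) \<longlongrightarrow> (1 + 0) * b) (at_right 0)"
        by (intro tendsto_intros)
      then show ?thesis
        using order_tendstoD(2)[of _ b "at_right 0" a] that by (auto simp: not_le)
    qed
    have "\<not> near_isometry 0 P"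
      using no that by blast
    then obtain n where n: "n \<in> test_vecs" and
      "norm (inv \<sigma>b (real_vec n)) < norm (inv \<sigma>a (real_vec (P *v n))) \<or>
       norm (inv \<sigma>a (real_vec (P *v n))) < norm (inv \<sigma>b (real_vec n))"
      unfolding near_isometry_def by (auto simp: not_le)
    from this(2) show ?thesis
    proof
      assume "norm (inv \<sigma>b (real_vec n)) < norm (inv \<sigma>a (real_vec (P *v n)))"
      from *[OF this] show ?thesis
        by (rule eventually_mono) (use n in \<open>auto simp: near_isometry_def\<close>)
    next
      assume "norm (inv \<sigma>a (real_vec (P *v n))) < norm (inv \<sigma>b (real_vec n))"
      from *[OF this] show ?thesis
        by (rule eventually_mono) (use n in \<open>auto simp: near_isometry_def\<close>)
    qed
  qed
  have "finite ?S"
    by (rule finite_subset[OF _ finite_near_isometry]) auto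
  then have "eventually (\<lambda>\<epsilon>. \<forall>P\<in>?S. \<not> near_isometry \<epsilon> P) (at_right 0)"
    using ev by (intro eventually_ball_finite) auto
  moreover have "eventually (\<lambda>\<epsilon>::real. 0 < \<epsilon>) (at_right 0)" "eventually (\<lambda>\<epsilon>::real. \<epsilon> < 1) (at_right 0)"
    by (rule eventually_at_right_less) (auto simp: eventually_at_right_field intro!: exI[of _ 1])
  ultimately have "eventually (\<lambda>\<epsilon>. (\<forall>P\<in>?S. \<not> near_isometry \<epsilon> P) \<and> 0 < \<epsilon> \<and> \<epsilon> < 1) (at_right 0)"
    by eventually_elim simp
  then obtain \<epsilon> where \<epsilon>: "\<forall>P\<in>?S. \<not> near_isometry \<epsilon> P" "0 < \<epsilon>" "\<epsilon> < 1"
    using eventually_happens[of _ "at_right (0::real)"] by auto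
  obtain P where P: "invertible P" "near_isometry \<epsilon> P"
    using ex_near_isometry[OF \<epsilon>(2)] by blast
  have "near_isometry 1 P"
    unfolding near_isometry_def
  proof (intro ballI conjI)
    fix n assume n: "n \<in> test_vecs"
    have le: "(1 + \<epsilon>) * norm v \<le> (1 + 1) * norm v" for v :: "real ^ 'd"
      using \<epsilon>(3) by (intro mult_right_mono) auto
    show "norm (inv \<sigma>a (real_vec (P *v n))) \<le> (1 + 1) * norm (inv \<sigma>b (real_vec n))"
      "norm (inv \<sigma>b (real_vec n)) \<le> (1 + 1) * norm (inv \<sigma>a (real_vec (P *v n)))"
      using P(2) n le order_trans unfolding near_isometry_def by blast+
  qed
  with P \<epsilon>(1) show False by blast
qed

text \<open>The map \<open>Q\<close> is built so that \<open>\<sigma>a \<circ> Q\<close> is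
  \<open>A\<close> after \<open>\<sigma>b\<close>. Its orthogonality is the equality of the Gram
  forms of \<open>T\<close> and \<open>S\<close>, which polarisation yields on the standard
  basis.\<close>

theorem double_coset_eq: "double_coset (matrix \<sigma>a) = double_coset (matrix \<sigma>b)"
proof -
  obtain P where P: "invertible P" "near_isometry 0 P"
    using ex_exact_isometry by blast
  define A where "A = map_matrix real_of_int P"
  have A: "A \<in> GL_int"
    using P(1) by (auto simp: GL_int_def A_def)
  define S where "S v = inv \<sigma>b v" for v
  define T where "T v = inv \<sigma>a (A *v v)" for v
  have linS: "linear S" and linT: "linear T"
    using linear_inv(2) linear_compose[OF matrix_vector_mul_linear linear_inv(1), of A]
    by (simp_all add: S_def[abs_def] T_def[abs_def] o_def)
  have norm_eq: "norm (T (real_vec n)) = norm (S (real_vec n))" if "n \<in> test_vecs" for n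
    using P(2) that by (auto simp: near_isometry_def T_def S_def A_def real_vec_matrix)
  have axis: "real_vec (axis i 1) = axis i 1" for i :: 'd
    by (simp add: vec_eq_iff axis_def)
  have inner_axis: "inner (T (axis i 1)) (T (axis j 1)) = inner (S (axis i 1)) (S (axis j 1))" for i j
  proof -
    have "norm (T (axis k 1)) = norm (S (axis k 1))" for k
      using norm_eq[of "axis k 1"] by (simp add: axis test_vecs_def)
    moreover have "axis i 1 + axis j 1 \<in> test_vecs"
      unfolding test_vecs_def by (intro UnI2 image_eqI[of _ _ "(i, j)"]) auto
    from norm_eq[OF this] have "norm (T (axis i 1) + T (axis j 1)) = norm (S (axis i 1) + S (axis j 1))"
      by (simp add: axis real_vec_add linear_add[OF linS] linear_add[OF linT])
    ultimately show ?thesis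
      by (simp add: dot_norm)
  qed
  have bil: "bilinear (\<lambda>x y. inner (L x) (L y))" if "linear L" for L :: "real ^ 'd \<Rightarrow> real ^ 'd"
    unfolding bilinear_def
    by (auto intro!: linearI simp: linear_add[OF that] linear_scale[OF that] inner_add_left inner_add_right)
  have "(\<lambda>x y. inner (T x) (T y)) = (\<lambda>x y. inner (S x) (S y))"
    by (rule bilinear_eq_stdbasis[OF bil[OF linT] bil[OF linS]])
      (auto simp: Basis_vec_def inner_axis)
  then have TS: "inner (T x) (T y) = inner (S x) (S y)" for x y
    by meson
  define Q where "Q = T \<circ> \<sigma>b"
  have linQ: "linear Q"
    unfolding Q_def by (rule linear_compose[OF lin_b linT])
  have "inner (Q x) (Q y) = inner x y" for x y
    using bij_b by (simp add: Q_def TS S_def bij_is_inj)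
  then have "orthogonal_transformation Q"
    using linQ by (simp add: orthogonal_transformation_def)
  then have orth: "orthogonal_matrix (matrix Q)"
    by (simp add: orthogonal_transformation_matrix)
  have "\<sigma>a \<circ> Q = (\<lambda>v. A *v v) \<circ> \<sigma>b"
    by (simp add: Q_def T_def fun_eq_iff)
  then have "matrix \<sigma>a ** matrix Q = A ** matrix \<sigma>b"
    using matrix_compose[OF linQ lin_a] matrix_compose[OF lin_b matrix_vector_mul_linear, of A]
    by simp
  then have "matrix \<sigma>a = A ** matrix \<sigma>b ** transpose (matrix Q)"
    using orth by (metis matrix_mul_assoc matrix_mul_rid orthogonal_matrix_def)
  then show ?thesis
    using A orth by (intro double_coset_eqI[of _ A _ "transpose (matrix Q)"])
      (simp_all add: orthogonal_matrix_transpose)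
qed

end

theorem mainTheorem19:
  fixes \<sigma>\<^sub>1 \<sigma>\<^sub>2 :: "real ^ 'd \<Rightarrow> real ^ 'd::finite"
  assumes "linear \<sigma>\<^sub>1" and "bij \<sigma>\<^sub>1"
    and "linear \<sigma>\<^sub>2" and "bij \<sigma>\<^sub>2"
    and "double_coset (matrix \<sigma>\<^sub>1) \<noteq> double_coset (matrix \<sigma>\<^sub>2)"
  shows "\<not> isometric (g_TN \<sigma>\<^sub>1) (g_TN \<sigma>\<^sub>2)"
  using isometric_imp_speed_isometry[OF assms(1-4)] speed_isometry.double_coset_eq assms(5) by blast

end
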